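(* Let $\omega=\omega_{FS}$ be the Fubini–Study form on $\mathbb{CP}^N$ and let $K\subset\mathbb{C}^N\cong\{Z_0\neq0\}\subset\mathbb{CP}^N$ be a Borel set. (a) Let $Q$ be a mild function on $\mathbb{CP}^N$ with respect to $\omega$, and define $q$ on $\mathbb{C}^N$ by $$q(z_1,\dots,z_N)=q(Z_1/Z_0,\dots,Z_N/Z_0)=Q(Z)+\log(\|Z\|/|Z_0|),\qquad Z_0\neq0.$$ Then $$V_{K,q}(x)=V_{K,\omega,Q}(x)+\tfrac12\log(1+\|x\|^2),\qquad x\in\mathbb{C}^N.$$ (b) Conversely, let $q:\mathbb{C}^N\to\mathbb{R}\cup\{+\infty\}$ be lower semicontinuous, and define $$Q(Z)=q(Z_1/Z_0,\dots,Z_N/Z_0)-\log\|Z\|+\log|Z_0|,\qquad Z_0\neq0,$$ extended to $\{Z_0=0\}$ by its lower semicontinuous regularization as $Z_0\to0$. Then the same equality $V_{K,q}(x)=V_{K,\omega,Q}(x)+\tfrac12\log(1+\|x\|^2)$ holds for all $x\in\mathbb{C}^N$.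
   Context: $[Z_0:\dots:Z_N]$ are homogeneous coordinates on $\mathbb{CP}^N$, $\|Z\|^2=\sum_{j}|Z_j|^2$, $U_j=\{Z_j\neq0\}$, and $U_0$ is identified with $\mathbb{C}^N$ through $z_k=Z_k/Z_0$. The Fubini–Study form $\omega=\omega_{FS}$ is normalized so that $\omega=dd^c\phi_j$ in $U_j$ with $\phi_j=\tfrac12\log\big(1+\sum_{k\neq j}|Z_k/Z_j|^2\big)$. $PSH(\mathbb{CP}^N,\omega)$ is the set of upper semicontinuous functions $v\in L^1(\mathbb{CP}^N,\mathbb{R}\cup\{-\infty\})$ with $dd^cv\geq-\omega$. A mild function (with respect to $\omega$) is a function $Q:\mathbb{CP}^N\to\mathbb{R}\cup\{+\infty\}$ such that $\exp(-Q+\phi_j)$ is continuous in $U_j$ for every $j$ and $\{Q\neq+\infty\}$ is not pluripolar. For a function $Q$ on $\mathbb{CP}^N$, $$V_{K,\omega,Q}(x)=\sup\{v(x):v\in PSH(\mathbb{CP}^N,\omega),\ v\leq Q\text{ on }K\}.$$ $\mathcal{L}=\mathcal{L}(\mathbb{C}^N)$ is the class of plurisubharmonic functions $u$ (not identically $-\infty$) on $\mathbb{C}^N$ with logarithmic growth: $u(z)\leq\log^+\|z\|+C_u$ for some constant $C_u$. For a function $q$ on $\mathbb{C}^N$, $V_{K,q}(x)=\sup\{u(x):u\in\mathcal{L},\ u\leq q\text{ on }K\}$. *)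

theory Defs
  imports "HOL-Analysis.Analysis"
begin

section \<open>Complex projective space\<close>

text \<open>
  Throughout, \<open>N = CARD('n)\<close>.  Homogeneous coordinates \<open>Z\<^sub>0, \<dots>, Z\<^sub>N\<close> are indexed by
  \<open>'n option\<close>: \<open>None\<close> is the index \<open>0\<close>, and \<open>Some k\<close>, with \<open>k :: 'n\<close>, are the indices
  \<open>1, \<dots>, N\<close>.
\<close>

definition cproj_rel :: "complex ^ ('n::finite option) \<Rightarrow> complex ^ 'n option \<Rightarrow> bool" where
  "cproj_rel Z W \<longleftrightarrow> Z \<noteq> 0 \<and> W \<noteq> 0 \<and> (\<exists>c. c \<noteq> 0 \<and> W = c *s Z)"

lemma part_equivp_cproj_rel: "part_equivp (cproj_rel :: complex ^ ('n::finite option) \<Rightarrow> _)"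
proof (rule part_equivpI)
  show "\<exists>x. cproj_rel x (x :: complex ^ 'n option)"
    by (rule exI[of _ "\<chi> i. 1"]) (auto simp: cproj_rel_def vec_eq_iff intro!: exI[of _ 1])
  show "symp (cproj_rel :: complex ^ 'n option \<Rightarrow> _)"
  proof (rule sympI)
    fix Z W :: "complex ^ 'n option"
    assume "cproj_rel Z W"
    then obtain c where c: "Z \<noteq> 0" "W \<noteq> 0" "c \<noteq> 0" "W = c *s Z"
      unfolding cproj_rel_def by blast
    then have "Z = inverse c *s W"
      by (simp add: vec_eq_iff)
    with c show "cproj_rel W Z"
      unfolding cproj_rel_def by (metis inverse_nonzero_iff_nonzero)
  qed
  show "transp (cproj_rel :: complex ^ 'n option \<Rightarrow> _)"
  proof (rule transpI)
    fix Z W Y :: "complex ^ 'n option"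
    assume "cproj_rel Z W" "cproj_rel W Y"
    then obtain c d where c: "Z \<noteq> 0" "Y \<noteq> 0" "c \<noteq> 0" "d \<noteq> 0" "W = c *s Z" "Y = d *s W"
      unfolding cproj_rel_def by blast
    then have "Y = (d * c) *s Z"
      by (simp add: vec_eq_iff)
    with c show "cproj_rel Z Y"
      unfolding cproj_rel_def by (metis mult_eq_0_iff)
  qed
qed

quotient_type 'n cproj = "complex ^ ('n::finite option)" / partial: cproj_rel
  by (rule part_equivp_cproj_rel)

text \<open>\<open>proj Z\<close> is the point \<open>[Z\<^sub>0 : \<dots> : Z\<^sub>N]\<close>; it is meaningful only for \<open>Z \<noteq> 0\<close>.\<close>

definition proj :: "complex ^ 'n option \<Rightarrow> ('n::finite) cproj" where
  "proj Z = abs_cproj Z"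

lemma proj_eq_iff:
  assumes "Z \<noteq> 0" "W \<noteq> 0"
  shows "proj Z = proj W \<longleftrightarrow> (\<exists>c. c \<noteq> 0 \<and> W = c *s Z)"
proof -
  have "cproj_rel Z Z" "cproj_rel W W"
    using assms by (auto simp: cproj_rel_def intro!: exI[of _ 1])
  then show ?thesis
    unfolding proj_def using Quotient3_rel[OF Quotient3_cproj, of Z W] assms
    by (auto simp: cproj_rel_def)
qed

lemma proj_surj: obtains Z where "Z \<noteq> 0" "p = proj Z"
proof -
  have "cproj_rel (rep_cproj p) (rep_cproj p)" "abs_cproj (rep_cproj p) = p"
    using Quotient3_cproj Quotient3_abs_rep Quotient3_rep_reflp by fastforce+
  then show ?thesis
    using that unfolding proj_def cproj_rel_def by metis
qed

instantiation cproj :: (finite) topological_space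
begin

definition open_cproj :: "'a cproj set \<Rightarrow> bool" where
  "open_cproj U \<longleftrightarrow> open {Z. Z \<noteq> 0 \<and> proj Z \<in> U}"

instance
proof
  have "{Z :: complex ^ 'a option. Z \<noteq> 0 \<and> proj Z \<in> UNIV} = - {0}"
    by auto
  then show "open (UNIV :: 'a cproj set)"
    unfolding open_cproj_def by (simp add: open_Compl)
next
  fix S T :: "'a cproj set"
  assume "open S" "open T"
  moreover have "{Z. Z \<noteq> 0 \<and> proj Z \<in> S \<inter> T} = {Z. Z \<noteq> 0 \<and> proj Z \<in> S} \<inter> {Z. Z \<noteq> 0 \<and> proj Z \<in> T}"
    by auto
  ultimately show "open (S \<inter> T)"
    unfolding open_cproj_def by (simp add: open_Int)
next
  fix K :: "'a cproj set set"
  assume "\<forall>S\<in>K. open S"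
  moreover have "{Z. Z \<noteq> 0 \<and> proj Z \<in> \<Union>K} = (\<Union>S\<in>K. {Z. Z \<noteq> 0 \<and> proj Z \<in> S})"
    by auto
  ultimately show "open (\<Union>K)"
    unfolding open_cproj_def by (simp add: open_UN)
qed

end

definition chart_domain :: "'n option \<Rightarrow> ('n::finite) cproj set" where
  "chart_domain j = {proj Z | Z. Z $ j \<noteq> 0}"

text \<open>
  \<open>chart j\<close> identifies \<open>\<complex>\<^sup>N\<close> with \<open>U\<^sub>j\<close>: coordinate \<open>j\<close> is set to \<open>1\<close> and the remaining ones are
  filled with \<open>z\<close>, where for \<open>j = Some k\<close> the entry \<open>z\<^sub>k\<close>, whose slot is taken, moves to slot \<open>None\<close>.
  In particular \<open>chart None z = [1 : z\<^sub>1 : \<dots> : z\<^sub>N]\<close>.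
\<close>

definition chart :: "'n option \<Rightarrow> complex ^ 'n \<Rightarrow> ('n::finite) cproj" where
  "chart j z = proj (\<chi> i. if i = j then 1 else case i of Some k \<Rightarrow> z $ k | None \<Rightarrow> z $ the j)"

lemma range_chart: "range (chart j) = chart_domain j"
proof (intro equalityI subsetI)
  fix p assume "p \<in> range (chart j)"
  then obtain z where "p = chart j z" by auto
  then show "p \<in> chart_domain j"
    unfolding chart_def chart_domain_def by (auto intro!: exI)
next
  fix p assume "p \<in> chart_domain j"
  then obtain Z where Z: "Z $ j \<noteq> 0" "p = proj Z"
    unfolding chart_domain_def by auto
  define z where "z = (\<chi> k. if j = Some k then Z $ None / Z $ j else Z $ Some k / Z $ j)"
  define W where "W = (\<chi> i. if i = j then 1 else case i of Some k \<Rightarrow> z $ k | None \<Rightarrow> z $ the j)"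
  have W: "W = inverse (Z $ j) *s Z"
    using Z(1) by (auto simp: W_def z_def vec_eq_iff divide_inverse split: option.splits)
  have "Z \<noteq> 0" "W \<noteq> 0"
    using Z(1) W by (auto simp: vec_eq_iff)
  then have "proj Z = proj W"
    using W Z(1) by (subst proj_eq_iff) (auto intro!: exI[of _ "inverse (Z $ j)"])
  then show "p \<in> range (chart j)"
    using Z(2) by (auto simp: chart_def W_def)
qed

definition affine_coords :: "complex ^ 'n option \<Rightarrow> complex ^ ('n::finite)" where
  "affine_coords Z = (\<chi> k. Z $ Some k / Z $ None)"

lemma chart_None_affine_coords:
  assumes "Z $ None \<noteq> 0"
  shows "chart None (affine_coords Z) = proj Z"
proof -
  define W where "W = (\<chi> i. if i = None then 1 else case i of Some k \<Rightarrow> affine_coords Z $ k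
      | None \<Rightarrow> affine_coords Z $ the None)"
  have W: "W = inverse (Z $ None) *s Z"
    using assms by (auto simp: W_def affine_coords_def vec_eq_iff divide_inverse split: option.splits)
  have "Z \<noteq> 0" "W \<noteq> 0"
    using assms W by (auto simp: vec_eq_iff)
  then have "proj Z = proj W"
    using W assms by (subst proj_eq_iff) (auto intro!: exI[of _ "inverse (Z $ None)"])
  then show ?thesis
    by (simp add: chart_def W_def)
qed


section \<open>Plurisubharmonic functions\<close>

definition usc_on :: "'a::topological_space set \<Rightarrow> ('a \<Rightarrow> ereal) \<Rightarrow> bool" where
  "usc_on S f \<longleftrightarrow> (\<forall>a\<in>S. \<forall>c. f a < c \<longrightarrow> (\<forall>\<^sub>F x in at a within S. f x < c))"

definition lsc_on :: "'a::topological_space set \<Rightarrow> ('a \<Rightarrow> ereal) \<Rightarrow> bool" where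
  "lsc_on S f \<longleftrightarrow> (\<forall>a\<in>S. \<forall>c. c < f a \<longrightarrow> (\<forall>\<^sub>F x in at a within S. c < f x))"

text \<open>
  The mean \<open>1/(2\<pi>) \<integral> f(a + e\<^sup>i\<^sup>\<theta> b) d\<theta>\<close> over \<open>[0, 2\<pi>]\<close>, as positive part minus negative part.  It is used
  for upper semicontinuous \<open>f < \<infinity>\<close>, for which the positive part has finite integral; the
  value may be \<open>-\<infinity>\<close>.
\<close>

definition circle_mean :: "(complex ^ 'n::finite \<Rightarrow> ereal) \<Rightarrow> complex ^ 'n \<Rightarrow> complex ^ 'n \<Rightarrow> ereal" where
  "circle_mean f a b =
     (enn2ereal (\<integral>\<^sup>+\<theta>\<in>{0..2*pi}. e2ennreal (f (a + cis \<theta> *s b)) \<partial>lborel)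
      - enn2ereal (\<integral>\<^sup>+\<theta>\<in>{0..2*pi}. e2ennreal (- f (a + cis \<theta> *s b)) \<partial>lborel)) / ereal (2 * pi)"

text \<open>The function that is identically \<open>-\<infinity>\<close> counts as plurisubharmonic.\<close>

definition psh_on :: "(complex ^ 'n::finite) set \<Rightarrow> (complex ^ 'n \<Rightarrow> ereal) \<Rightarrow> bool" where
  "psh_on \<Omega> f \<longleftrightarrow>
     (\<forall>z\<in>\<Omega>. f z \<noteq> \<infinity>) \<and> usc_on \<Omega> f \<and>
     (\<forall>a b. (\<forall>\<zeta>. cmod \<zeta> \<le> 1 \<longrightarrow> a + \<zeta> *s b \<in> \<Omega>) \<longrightarrow> f a \<le> circle_mean f a b)"

text \<open>The Lelong class; note that \<open>ln 0 = 0\<close>, so \<open>max 0 (ln (norm z))\<close> is \<open>log\<^sup>+ \<parallel>z\<parallel>\<close> also at \<open>0\<close>.\<close>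

definition lelong_class :: "(complex ^ 'n::finite \<Rightarrow> ereal) set" where
  "lelong_class = {u. psh_on UNIV u \<and> (\<exists>z. u z \<noteq> -\<infinity>) \<and>
     (\<exists>C::real. \<forall>z. u z \<le> ereal (max 0 (ln (norm z)) + C))}"

definition V_aff :: "(complex ^ 'n::finite) set \<Rightarrow> (complex ^ 'n \<Rightarrow> ereal) \<Rightarrow> complex ^ 'n \<Rightarrow> ereal" where
  "V_aff K q x = Sup {u x | u. u \<in> lelong_class \<and> (\<forall>z\<in>K. u z \<le> q z)}"


section \<open>The Fubini--Study form and \<open>\<omega>\<close>-plurisubharmonic functions\<close>

text \<open>The local potential \<open>\<phi>\<^sub>j\<close> of \<open>\<omega>\<close>; it is meaningful only on \<open>U\<^sub>j\<close>.\<close>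

lift_definition fs_potential :: "'n option \<Rightarrow> ('n::finite) cproj \<Rightarrow> real" is
  "\<lambda>j Z. 1/2 * ln (1 + (\<Sum>k\<in>UNIV - {j}. (cmod (Z $ k / Z $ j))\<^sup>2))"
  by (auto simp: cproj_rel_def)

text \<open>
  The volume measure \<open>\<omega>\<^sup>N\<close>, for \<open>dd\<^sup>c = (i/\<pi>) \<partial>\<partial>\<close>-bar.  In \<open>U\<^sub>0\<close> it has density
  \<open>N!/\<pi>\<^sup>N (1 + \<parallel>z\<parallel>\<^sup>2)\<^sup>-\<^sup>N\<^sup>-\<^sup>1\<close> with respect to Lebesgue measure, and the hyperplane \<open>Z\<^sub>0 = 0\<close> is a null set.
\<close>

definition fs_measure :: "('n::finite) cproj measure" where
  "fs_measure = distr
     (density lborel (\<lambda>z :: complex ^ 'n.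
        ennreal (fact CARD('n) / pi ^ CARD('n) / (1 + (norm z)\<^sup>2) ^ (CARD('n) + 1))))
     borel (chart None)"

text \<open>
  Since \<open>\<omega> = dd\<^sup>c \<phi>\<^sub>j\<close> on \<open>U\<^sub>j\<close>, the condition \<open>dd\<^sup>c v \<ge> -\<omega>\<close> says \<open>dd\<^sup>c (v + \<phi>\<^sub>j) \<ge> 0\<close> on every \<open>U\<^sub>j\<close>, that is,
  \<open>v + \<phi>\<^sub>j\<close> is plurisubharmonic there.  As usual this is a condition on the function \<open>v\<close> itself, not
  only on its almost-everywhere class.
\<close>

definition omega_psh :: "(('n::finite) cproj \<Rightarrow> ereal) set" where
  "omega_psh = {v. (\<forall>p. v p \<noteq> \<infinity>) \<and> usc_on UNIV v \<and>
     (\<integral>\<^sup>+p. e2ennreal \<bar>v p\<bar> \<partial>fs_measure) < \<infinity> \<and>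
     (\<forall>j. psh_on UNIV (\<lambda>z. v (chart j z) + ereal (fs_potential j (chart j z))))}"

definition V_omega :: "('n::finite) cproj set \<Rightarrow> ('n cproj \<Rightarrow> ereal) \<Rightarrow> 'n cproj \<Rightarrow> ereal" where
  "V_omega K Q x = Sup {v x | v. v \<in> omega_psh \<and> (\<forall>p\<in>K. v p \<le> Q p)}"


section \<open>Mild functions\<close>

definition pluripolar :: "('n::finite) cproj set \<Rightarrow> bool" where
  "pluripolar E \<longleftrightarrow> (\<forall>p\<in>E. \<exists>j \<Omega> u. open \<Omega> \<and> connected \<Omega> \<and> p \<in> chart j ` \<Omega> \<and>
     psh_on \<Omega> u \<and> (\<exists>z\<in>\<Omega>. u z \<noteq> -\<infinity>) \<and> (\<forall>z\<in>\<Omega>. chart j z \<in> E \<longrightarrow> u z = -\<infinity>))"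

definition exp_ereal :: "ereal \<Rightarrow> ereal" where
  "exp_ereal x = (if x = -\<infinity> then 0 else if x = \<infinity> then \<infinity> else ereal (exp (real_of_ereal x)))"

definition mild :: "(('n::finite) cproj \<Rightarrow> ereal) \<Rightarrow> bool" where
  "mild Q \<longleftrightarrow> (\<forall>p. Q p \<noteq> -\<infinity>) \<and>
     (\<forall>j. continuous_on (chart_domain j) (\<lambda>p. exp_ereal (- Q p + ereal (fs_potential j p)))) \<and>
     \<not> pluripolar {p. Q p \<noteq> \<infinity>}"

end

theory Submission
  imports Defs "HOL-Complex_Analysis.Cauchy_Integral_Formula"
begin

text \<open>
  Write \<open>\<phi>(z) = 1/2 log (1 + \<parallel>z\<parallel>\<^sup>2)\<close> for the potential in the chart \<open>U\<^sub>0\<close>.  Both equalities say that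
  \<open>v \<mapsto> v + \<phi>\<close>, restricted to \<open>U\<^sub>0\<close>, maps \<open>\<omega>\<close>-plurisubharmonic functions onto the Lelong
  class.  The constraint \<open>v \<le> Q\<close> on \<open>K\<close> becomes \<open>v + \<phi> \<le> q\<close>, so at each point the two suprema
  are taken over the same numbers, up to the shift by \<open>\<phi>\<close> (\<open>V_aff_eq_V_omega\<close>).

  One direction is soft (\<open>lelong_class_of_omega_psh\<close>): \<open>v\<close> is bounded above because projective space is
  compact, whence the logarithmic growth, and \<open>v\<close> is not identically \<open>-\<infinity>\<close> on \<open>U\<^sub>0\<close> because it is
  integrable.

  For the converse (\<open>omega_psh_of_lelong_class\<close>), \<open>u - \<phi>\<close> is bounded above for \<open>u\<close> in the Lelong class, and
  is extended over the hyperplane at infinity by upper semicontinuous regularization.  In the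
  chart \<open>U\<^sub>k\<close>, off the hyperplane \<open>z\<^sub>k = 0\<close>, the extension plus its potential is
  \<open>u(w(z)) + log |z\<^sub>k|\<close> with \<open>w\<close> the projective change of charts, and its plurisubharmonicity
  needs three arguments.

  \<^item> Along a complex line \<open>w\<close> is a Moebius transformation, which does not map concentric circles to concentric
    circles, so the mean value inequality has to be transported differently.  A function
    for which the mean value inequality holds cannot be touched from above, at a point where it is
    finite, by \<open>Re h - \<delta> |\<zeta> - \<zeta>\<^sub>0|\<^sup>2\<close> with \<open>h\<close> holomorphic and \<open>\<delta> > 0\<close> (\<open>psh_no_touching\<close>); this property is
    invariant under holomorphic changes of the variable (\<open>psh_projective_no_touching\<close>).  Conversely it
    implies the mean value inequality on the unit disc (\<open>submean_from_no_touching\<close>): it gives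
    the maximum principle against real parts of polynomials, these are dense in the continuous
    functions on the circle, and an upper semicontinuous function is a decreasing limit of continuous ones.

  \<^item> A line through a point with \<open>z\<^sub>k \<noteq> 0\<close> may still meet the hyperplane.  Adding \<open>\<epsilon> log |z\<^sub>k|\<close>
    makes the function \<open>-\<infinity>\<close> there, so that no touching is possible at the singular point; then
    \<open>\<epsilon> \<rightarrow> 0\<close> (\<open>psh_projective_submean\<close>).

  \<^item> At points of the hyperplane the inequality follows from the nearby ones by Fatou's lemma, the extension
    being the upper limit of its values off the hyperplane (\<open>circle_mean_ge_limit\<close>).

  Integrability of the extension follows from the mean value inequality on all circles around a single
  point where \<open>u\<close> is finite: the volume density is comparable to one that is invariant under \<open>z \<mapsto> e\<^sup>i\<^sup>\<theta> z\<close>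
  around that point, and averaging over \<open>\<theta>\<close> bounds the integral (\<open>lelong_deficit_integrable\<close>).
\<close>

section \<open>Semicontinuous functions\<close>

lemma usc_on_UNIV_iff:
  fixes f :: "'a::topological_space \<Rightarrow> ereal"
  shows "usc_on UNIV f \<longleftrightarrow> (\<forall>c. open {x. f x < c})"
proof
  assume u: "usc_on UNIV f"
  show "\<forall>c. open {x. f x < c}"
  proof
    fix c show "open {x. f x < c}"
    proof (subst open_subopen, rule ballI)
      fix a assume a: "a \<in> {x. f x < c}"
      with u have "\<forall>\<^sub>F x in at a. f x < c" by (auto simp: usc_on_def)
      with a have "\<forall>\<^sub>F x in nhds a. f x < c"
        by (simp add: eventually_nhds_conv_at)
      then show "\<exists>T. open T \<and> a \<in> T \<and> T \<subseteq> {x. f x < c}"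
        by (auto simp: eventually_nhds)
    qed
  qed
next
  assume o: "\<forall>c. open {x. f x < c}"
  show "usc_on UNIV f" unfolding usc_on_def
  proof (intro ballI allI impI)
    fix a c assume "f a < c"
    then have "\<forall>\<^sub>F x in nhds a. f x < c"
      using o by (auto simp: eventually_nhds)
    then show "\<forall>\<^sub>F x in at a. f x < c"
      by (simp add: eventually_nhds_conv_at)
  qed
qed

lemma usc_on_UNIV_ereal_iff:
  fixes f :: "'a::topological_space \<Rightarrow> ereal"
  assumes fin: "\<And>x. f x \<noteq> \<infinity>"
  shows "usc_on UNIV f \<longleftrightarrow> (\<forall>r. open {x. f x < ereal r})"
proof
  assume o: "\<forall>r. open {x. f x < ereal r}"
  have "open {x. f x < c}" for c
    using o fin by (cases c) auto
  then show "usc_on UNIV f" by (auto simp: usc_on_UNIV_iff)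
qed (auto simp: usc_on_UNIV_iff)

lemma usc_borel_measurable:
  "usc_on UNIV f \<Longrightarrow> f \<in> borel_measurable borel"
  unfolding usc_on_UNIV_iff
  by (intro borel_measurableI_less) (auto intro!: borel_open)

lemma usc_compose:
  assumes "usc_on UNIV f" "continuous_on UNIV g"
  shows "usc_on UNIV (\<lambda>x. f (g x))"
proof -
  have "open (g -` {y. f y < c})" for c
    using assms by (intro open_vimage) (auto simp: usc_on_UNIV_iff)
  then show ?thesis by (simp add: usc_on_UNIV_iff vimage_def)
qed

text \<open>
  Since \<open>f x + g x < r\<close> holds exactly when some \<open>s\<close> separates, \<open>f x < s\<close> and \<open>g x < r - s\<close>, the
  sublevel sets of the sum are unions of open sets.
\<close>

lemma usc_add:
  fixes f g :: "'a::topological_space \<Rightarrow> ereal"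
  assumes f: "usc_on UNIV f" "\<And>x. f x \<noteq> \<infinity>" and g: "usc_on UNIV g" "\<And>x. g x \<noteq> \<infinity>"
  shows "usc_on UNIV (\<lambda>x. f x + g x)"
proof -
  have split: "\<exists>s. f x < ereal s \<and> g x < ereal (r - s)" if "f x + g x < ereal r" for x r
  proof -
    consider "f x = -\<infinity>" | "g x = -\<infinity>" | a b where "f x = ereal a" "g x = ereal b"
      using f(2)[of x] g(2)[of x] by (cases "f x"; cases "g x") auto
    then show ?thesis
    proof cases
      case 1
      then show ?thesis using g(2)[of x]
        by (cases "g x") (auto intro: exI[of _ "r - real_of_ereal (g x) - 1"] exI[of _ r])
    next
      case 2
      then show ?thesis using f(2)[of x]
        by (cases "f x") (auto intro: exI[of _ "real_of_ereal (f x) + 1"])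
    next
      case 3
      then show ?thesis using that by (auto intro!: exI[of _ "a + (r - a - b) / 2"] simp: field_simps)
    qed
  qed
  have "{x. f x + g x < ereal r} = (\<Union>s. {x. f x < ereal s} \<inter> {x. g x < ereal (r - s)})" for r
  proof (intro equalityI subsetI)
    fix x assume "x \<in> (\<Union>s. {x. f x < ereal s} \<inter> {x. g x < ereal (r - s)})"
    then obtain s where "f x < ereal s" "g x < ereal (r - s)" by auto
    then have "f x + g x < ereal s + ereal (r - s)"
      by (cases "f x"; cases "g x") auto
    then show "x \<in> {x. f x + g x < ereal r}" by simp
  qed (use split in auto)
  moreover have "open (\<Union>s. {x. f x < ereal s} \<inter> {x. g x < ereal (r - s)})" for r
    using f(1) g(1) unfolding usc_on_UNIV_iff by (intro open_UN ballI open_Int) blast+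
  ultimately show ?thesis
    by (subst usc_on_UNIV_ereal_iff) (auto simp: f g)
qed

lemma continuous_imp_usc:
  fixes f :: "'a::topological_space \<Rightarrow> real"
  assumes "continuous_on UNIV f"
  shows "usc_on UNIV (\<lambda>x. ereal (f x))"
  by (subst usc_on_UNIV_ereal_iff) (auto intro!: open_Collect_less assms continuous_intros)

lemma usc_bounded_above_on_compact:
  assumes "usc_on UNIV f" "\<And>x. f x \<noteq> (\<infinity>::ereal)" "compact S"
  obtains M :: real where "0 \<le> M" "\<And>x. x \<in> S \<Longrightarrow> f x \<le> ereal M"
proof -
  have "\<exists>n::nat. f x < ereal (real n)" for x
    using assms(2)[of x] reals_Archimedean2 by (cases "f x") auto
  then have "S \<subseteq> (\<Union>n::nat\<in>UNIV. {x. f x < ereal (real n)})" by auto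
  moreover have op: "open {x. f x < ereal (real n)}" for n
    using assms(1) by (simp add: usc_on_UNIV_iff)
  ultimately obtain I :: "nat set" where I: "finite I" "S \<subseteq> (\<Union>n\<in>I. {x. f x < ereal (real n)})"
    using compactE_image[OF assms(3), of UNIV "\<lambda>n. {x. f x < ereal (real n)}", OF op] by metis
  show ?thesis
  proof (rule that[of "real (Max (insert 0 I))"])
    fix x assume "x \<in> S"
    then obtain n where "n \<in> I" "f x < ereal (real n)" using I by auto
    moreover from this have "real n \<le> real (Max (insert 0 I))"
      using I(1) by simp
    ultimately show "f x \<le> ereal (real (Max (insert 0 I)))"
      using ereal_less_eq(3) less_imp_le order_trans by blast
  qed simp
qed

lemma usc_attains_sup:
  fixes f :: "'a::topological_space \<Rightarrow> ereal"
  assumes u: "usc_on UNIV f" and S: "compact S" "S \<noteq> {}"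
  obtains a where "a \<in> S" "\<And>x. x \<in> S \<Longrightarrow> f x \<le> f a"
proof -
  define m where "m = (SUP x\<in>S. f x)"
  have "\<exists>a\<in>S. f a = m"
  proof (rule ccontr)
    assume "\<not> (\<exists>a\<in>S. f a = m)"
    then have lt: "f x < m" if "x \<in> S" for x
      using that unfolding m_def by (metis SUP_upper order_le_imp_less_or_eq)
    have cov: "S \<subseteq> (\<Union>c\<in>{..<m}. {x. f x < c})"
      using lt dense by fastforce
    have op: "open {x. f x < c}" for c
      using u by (simp add: usc_on_UNIV_iff)
    obtain C where C: "C \<subseteq> {..<m}" "finite C" "S \<subseteq> (\<Union>c\<in>C. {x. f x < c})"
      using compactE_image[OF S(1), of "{..<m}" "\<lambda>c. {x. f x < c}", OF op cov] by metis
    then have ne: "C \<noteq> {}" using S(2) by auto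
    have "m \<le> Max C"
      unfolding m_def
    proof (rule SUP_least)
      fix x assume "x \<in> S"
      then obtain c where "c \<in> C" "f x < c" using C(3) by auto
      then show "f x \<le> Max C" using C(2) by (meson Max_ge less_imp_le order_trans)
    qed
    moreover have "Max C < m" using Max_in[OF C(2) ne] C(1) by auto
    ultimately show False by simp
  qed
  then show ?thesis using that unfolding m_def by (metis SUP_upper)
qed

text \<open>
  The approximants are the Lipschitz regularizations \<open>inf\<^sub>y (min (k y) n + n dist x y)\<close>.  Truncating at \<open>n\<close>
  keeps them real-valued.
\<close>

lemma lsc_nonneg_eq_SUP_continuous:
  fixes k :: "'a::metric_space \<Rightarrow> ereal"
  assumes lsc: "\<And>c. open {x. c < k x}" and nonneg: "\<And>x. 0 \<le> k x"
  obtains f :: "nat \<Rightarrow> 'a \<Rightarrow> real"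
  where "\<And>n. continuous_on UNIV (f n)" "\<And>n x. 0 \<le> f n x" "\<And>x. mono (\<lambda>n. f n x)"
    "\<And>x. (SUP n. ereal (f n x)) = k x"
proof -
  define t where "t n y = real_of_ereal (min (k y) (ereal (real n)))" for n y
  have t: "ereal (t n y) = min (k y) (ereal (real n))" for n y
    using nonneg[of y] unfolding t_def by (cases "k y") (auto simp: min_def)
  have t0: "0 \<le> t n y" for n y
    using nonneg[of y] unfolding t_def by (simp add: real_of_ereal_pos)
  have t_mono: "t m y \<le> t n y" if "m \<le> n" for m n y
  proof -
    have "ereal (t m y) \<le> ereal (t n y)" unfolding t using that by (intro min.mono) auto
    then show ?thesis by simp
  qed
  define f where "f n x = (INF y. t n y + real n * dist x y)" for n x
  have bdd: "bdd_below (range (\<lambda>y. t n y + real n * dist x y))" for n x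
    by (rule bdd_belowI[of _ 0]) (use t0 in auto)
  have f0: "0 \<le> f n x" for n x
    unfolding f_def by (rule cINF_greatest) (use t0 in auto)
  have f_le: "f n x \<le> t n y + real n * dist x y" for n x y
    unfolding f_def by (rule cINF_lower[OF bdd]) auto
  have lip: "f n x \<le> f n x' + real n * dist x x'" for n x x'
  proof -
    have "f n x - real n * dist x x' \<le> f n x'"
      unfolding f_def[of n x']
    proof (rule cINF_greatest)
      fix y
      have "real n * dist x y \<le> real n * (dist x x' + dist x' y)"
        by (intro mult_left_mono dist_triangle) auto
      then show "f n x - real n * dist x x' \<le> t n y + real n * dist x' y"
        using f_le[of n x y] by (simp add: algebra_simps)
    qed auto
    then show ?thesis by simp
  qed
  have "(real n)-lipschitz_on UNIV (f n)" for n
  proof (rule lipschitz_onI)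
    fix x y show "dist (f n x) (f n y) \<le> real n * dist x y"
      using lip[of n x y] lip[of n y x] by (simp add: dist_real_def abs_le_iff dist_commute)
  qed auto
  then have cont: "continuous_on UNIV (f n)" for n by (rule lipschitz_on_continuous_on)
  have mono: "f m x \<le> f n x" if "m \<le> n" for m n x
    unfolding f_def[of n]
  proof (rule cINF_greatest)
    fix y
    have "real m * dist x y \<le> real n * dist x y" using that by (intro mult_right_mono) auto
    then show "f m x \<le> t n y + real n * dist x y"
      using f_le[of m x y] t_mono[OF that, of y] by linarith
  qed auto
  have sup: "(SUP n. ereal (f n x)) = k x" for x
  proof (rule antisym)
    show "(SUP n. ereal (f n x)) \<le> k x"
    proof (rule SUP_least)
      fix n
      have "ereal (f n x) \<le> ereal (t n x)" using f_le[of n x x] by simp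
      also have "\<dots> \<le> k x" by (simp add: t)
      finally show "ereal (f n x) \<le> k x" .
    qed
    show "k x \<le> (SUP n. ereal (f n x))"
    proof (rule dense_le)
      fix c assume c: "c < k x"
      show "c \<le> (SUP n. ereal (f n x))"
      proof (cases "c \<le> 0")
        case True
        have "0 \<le> ereal (f 0 x)" using f0 by simp
        then show ?thesis using True by (meson SUP_upper2 UNIV_I order_trans)
      next
        case False
        then obtain r where r: "c = ereal r" "0 < r" using c by (cases c) auto
        obtain d where d: "0 < d" "\<And>y. dist y x < d \<Longrightarrow> c < k y"
          using lsc[of c] c unfolding open_dist by blast
        obtain n :: nat where n: "max r (r / d) < real n" using reals_Archimedean2 by blast
        have "r \<le> f n x"
          unfolding f_def
        proof (rule cINF_greatest)
          fix y
          show "r \<le> t n y + real n * dist x y"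
          proof (cases "dist y x < d")
            case True
            then have "ereal r \<le> ereal (t n y)" unfolding t using d(2)[of y] n r by auto
            then show ?thesis by (simp add: add_increasing2)
          next
            case False
            then have "r \<le> real n * d" using n d(1) by (simp add: field_simps)
            also have "\<dots> \<le> real n * dist x y"
              using False by (intro mult_left_mono) (auto simp: dist_commute)
            finally show ?thesis using t0[of n y] by simp
          qed
        qed auto
        then have "c \<le> ereal (f n x)" using r by simp
        then show ?thesis by (meson SUP_upper2 UNIV_I)
      qed
    qed
  qed
  show ?thesis
    by (rule that[of f]) (use cont f0 mono sup in \<open>auto simp: monoI mono_def\<close>)
qed

section \<open>Means over circles\<close>

text \<open>
  The mean in \<open>circle_mean\<close>, for functions of the angle alone.
\<close>

definition arc_mean :: "(real \<Rightarrow> ereal) \<Rightarrow> ereal" where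
  "arc_mean h =
     (enn2ereal (\<integral>\<^sup>+\<theta>\<in>{0..2*pi}. e2ennreal (h \<theta>) \<partial>lborel)
      - enn2ereal (\<integral>\<^sup>+\<theta>\<in>{0..2*pi}. e2ennreal (- h \<theta>) \<partial>lborel)) / ereal (2 * pi)"

lemma circle_mean_eq_arc_mean: "circle_mean f a b = arc_mean (\<lambda>\<theta>. f (a + cis \<theta> *s b))"
  by (simp add: circle_mean_def arc_mean_def)

lemma arc_mean_mono:
  assumes "\<And>\<theta>. \<theta> \<in> {0..2*pi} \<Longrightarrow> h \<theta> \<le> k \<theta>"
  shows "arc_mean h \<le> arc_mean k"
  unfolding arc_mean_def
proof (rule ereal_divide_right_mono)
  show "enn2ereal (\<integral>\<^sup>+\<theta>\<in>{0..2*pi}. e2ennreal (h \<theta>) \<partial>lborel)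
      - enn2ereal (\<integral>\<^sup>+\<theta>\<in>{0..2*pi}. e2ennreal (- h \<theta>) \<partial>lborel)
    \<le> enn2ereal (\<integral>\<^sup>+\<theta>\<in>{0..2*pi}. e2ennreal (k \<theta>) \<partial>lborel)
      - enn2ereal (\<integral>\<^sup>+\<theta>\<in>{0..2*pi}. e2ennreal (- k \<theta>) \<partial>lborel)"
    using assms
    by (intro ereal_minus_mono less_eq_ennreal.rep_eq[THEN iffD1] nn_integral_mono)
       (auto intro!: e2ennreal_mono split: split_indicator)
qed auto

text \<open>
  Measuring \<open>h\<close> downwards from an upper bound \<open>M\<close> turns a lower bound for the mean, which may be
  \<open>\<infinity> - \<infinity>\<close> in disguise, into an upper bound for an integral of a nonnegative function.  This
  makes monotone convergence, Fatou's lemma and Tonelli's theorem applicable.  The reason is the pointwise identity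
  \<open>(M - h) + h\<^sup>+ = h\<^sup>- + M\<close>, in which \<open>h\<^sup>+ \<le> M\<close> has finite integral.
\<close>

lemma arc_mean_ge_iff:
  assumes h[measurable]: "h \<in> borel_measurable borel" and M: "0 \<le> M" "\<And>\<theta>. h \<theta> \<le> ereal M"
    and c: "c \<le> M"
  shows "ereal c \<le> arc_mean h \<longleftrightarrow>
    (\<integral>\<^sup>+\<theta>\<in>{0..2*pi}. e2ennreal (ereal M - h \<theta>) \<partial>lborel) \<le> ennreal (2*pi*(M-c))"
proof -
  let ?I = "\<lambda>f. \<integral>\<^sup>+\<theta>\<in>{0..2*pi}. f \<theta> \<partial>lborel"
  define D where "D = ?I (\<lambda>\<theta>. e2ennreal (ereal M - h \<theta>))"
  define P where "P = ?I (\<lambda>\<theta>. e2ennreal (h \<theta>))"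
  define N where "N = ?I (\<lambda>\<theta>. e2ennreal (- h \<theta>))"
  have pt: "e2ennreal (ereal M - h \<theta>) + e2ennreal (h \<theta>) = e2ennreal (- h \<theta>) + ennreal M" for \<theta>
  proof (cases "h \<theta>")
    case (real r)
    then have "r \<le> M" using M(2)[of \<theta>] by simp
    with real M(1) show ?thesis
      by (cases "0 \<le> r") (auto simp: ennreal_plus[symmetric] ennreal_neg simp del: ennreal_plus)
  qed (use M(2)[of \<theta>] in \<open>auto simp: e2ennreal_neg\<close>)
  have const: "?I (\<lambda>\<theta>. ennreal M) = ennreal (2*pi*M)"
    using M by (simp add: nn_integral_cmult_indicator ennreal_mult[symmetric] mult.commute)
  have "D + P = ?I (\<lambda>\<theta>. e2ennreal (ereal M - h \<theta>) + e2ennreal (h \<theta>))"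
    unfolding D_def P_def by (subst nn_integral_add[symmetric]) (auto simp: algebra_simps)
  also have "\<dots> = ?I (\<lambda>\<theta>. e2ennreal (- h \<theta>) + ennreal M)" by (simp add: pt)
  also have "\<dots> = N + ?I (\<lambda>\<theta>. ennreal M)"
    unfolding N_def by (subst nn_integral_add[symmetric]) (auto simp: algebra_simps)
  finally have eq: "D + P = N + ennreal (2*pi*M)" using const by simp
  have "P \<le> ?I (\<lambda>\<theta>. ennreal M)"
    unfolding P_def using M(2) e2ennreal_mono[of _ "ereal M"]
    by (intro nn_integral_mono) (auto split: split_indicator)
  then have P: "P < \<infinity>" using const by (simp add: less_top top_unique) (metis ennreal_less_top le_less_trans)
  have am: "arc_mean h = (enn2ereal P - enn2ereal N) / ereal (2*pi)"
    by (simp add: arc_mean_def P_def N_def)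
  show ?thesis
  proof (cases "D = \<infinity>")
    case True
    then have "N + ennreal (2*pi*M) = top" using eq by simp
    then have "N = \<infinity>" by (metis ennreal_add_eq_top ennreal_neq_top infinity_ennreal_def)
    moreover obtain p where "P = ennreal p" "0 \<le> p" using P by (cases P) auto
    ultimately have "arc_mean h = -\<infinity>" using am by (simp add: enn2ereal_ennreal)
    then show ?thesis using True unfolding D_def[symmetric]
      by (simp add: top_unique)
  next
    case False
    then have "D + P \<noteq> top" using P by (metis ennreal_add_eq_top infinity_ennreal_def less_irrefl)
    then have N: "N \<noteq> \<infinity>" using eq by auto
    obtain d where d: "D = ennreal d" "0 \<le> d" using False by (cases D) auto
    obtain p where p: "P = ennreal p" "0 \<le> p" using P by (cases P) auto
    obtain n where n: "N = ennreal n" "0 \<le> n" using N by (cases N) auto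
    note r = d p n
    with eq M have "d + p = n + 2*pi*M"
      by (simp add: ennreal_plus[symmetric] del: ennreal_plus)
    moreover have "arc_mean h = ereal ((p - n) / (2*pi))"
      using r am by (simp add: enn2ereal_ennreal)
    ultimately show ?thesis using r c M unfolding D_def[symmetric]
      by (auto simp: field_simps)
  qed
qed

lemma arc_mean_continuous:
  assumes k: "continuous_on {0..2*pi} k" and I: "(k has_integral I) {0..2*pi}"
  shows "arc_mean (\<lambda>\<theta>. ereal (k \<theta>)) = ereal (I / (2*pi))"
proof -
  let ?S = "{0..2*pi}"
  have ab: "set_integrable lborel ?S k"
    using borel_integrable_atLeastAtMost' k by blast
  then have i: "integrable lborel (\<lambda>x. indicator ?S x * k x)"
    by (simp add: set_integrable_def)
  have LI: "I = integral\<^sup>L lborel (\<lambda>x. indicator ?S x * k x)"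
    using has_integral_set_lebesgue set_borel_integral_eq_integral(2)[OF ab] integral_unique[OF I]
    by (simp add: set_lebesgue_integral_def)
  have e1: "(\<integral>\<^sup>+\<theta>\<in>?S. e2ennreal (ereal (k \<theta>)) \<partial>lborel) = (\<integral>\<^sup>+x. ennreal (indicator ?S x * k x) \<partial>lborel)"
    by (intro nn_integral_cong) (auto split: split_indicator)
  have e2: "(\<integral>\<^sup>+\<theta>\<in>?S. e2ennreal (- ereal (k \<theta>)) \<partial>lborel) = (\<integral>\<^sup>+x. ennreal (- (indicator ?S x * k x)) \<partial>lborel)"
    by (intro nn_integral_cong) (auto split: split_indicator)
  have f1: "(\<integral>\<^sup>+x. ennreal (indicator ?S x * k x) \<partial>lborel) < \<infinity>" 
    and f2: "(\<integral>\<^sup>+x. ennreal (- (indicator ?S x * k x)) \<partial>lborel) < \<infinity>"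
    using i unfolding real_integrable_def by (auto simp: less_top)
  obtain p where p: "(\<integral>\<^sup>+x. ennreal (indicator ?S x * k x) \<partial>lborel) = ennreal p" "0 \<le> p"
    using f1 by (cases "\<integral>\<^sup>+x. ennreal (indicator ?S x * k x) \<partial>lborel") auto
  obtain n where n: "(\<integral>\<^sup>+x. ennreal (- (indicator ?S x * k x)) \<partial>lborel) = ennreal n" "0 \<le> n"
    using f2 by (cases "\<integral>\<^sup>+x. ennreal (- (indicator ?S x * k x)) \<partial>lborel") auto
  have "I = p - n"
    unfolding LI using real_lebesgue_integral_def[OF i] p n by simp
  then show ?thesis
    unfolding arc_mean_def e1 e2 p(1) n(1) using p(2) n(2) by (simp add: enn2ereal_ennreal)
qed

lemma has_integral_circle_mean_value:
  assumes f: "f holomorphic_on ball 0 R" and r: "0 < r" "r < R"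
  shows "((\<lambda>\<theta>. f (of_real r * cis \<theta>)) has_integral (2 * of_real pi * f 0)) {0..2*pi}"
proof -
  have "f holomorphic_on cball 0 r" by (rule holomorphic_on_subset[OF f]) (use r in auto)
  then have "((\<lambda>u. f u / (u - 0)) has_contour_integral 2 * of_real pi * \<i> * f 0) (circlepath 0 r)"
    using Cauchy_integral_circlepath_simple[of f 0 r 0] r by simp
  then have "((\<lambda>t. f (0 + r * cis t) / (0 + r * cis t - 0) * r * \<i> * cis t) has_integral 2 * of_real pi * \<i> * f 0) {0..2*pi}"
    unfolding circlepath_def by (subst (asm) has_contour_integral_part_circlepath_iff) auto
  moreover have "f (0 + r * cis t) / (0 + r * cis t - 0) * r * \<i> * cis t = \<i> * f (r * cis t)" for t
    using r cis_neq_zero[of t] by simp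
  ultimately have "((\<lambda>t. \<i> * f (r * cis t)) has_integral 2 * of_real pi * \<i> * f 0) {0..2*pi}"
    by (simp only:)
  from has_integral_mult_right[OF this, of "-\<i>"] show ?thesis
    by (simp only: mult.assoc[symmetric]) (simp add: mult.commute mult.left_commute)
qed

lemma has_integral_circle_mean_value_Re:
  assumes f: "f holomorphic_on ball 0 R" and r: "0 < r" "r < R"
  shows "((\<lambda>\<theta>. Re (f (of_real r * cis \<theta>))) has_integral (2 * pi * Re (f 0))) {0..2*pi}"
  using has_integral_Re[OF has_integral_circle_mean_value[OF assms]] by simp

section \<open>Trigonometric polynomials on the unit circle\<close>

text \<open>
  On the unit circle \<open>z cnj z = 1\<close>, so mixed monomials \<open>z\<^sup>m (cnj z)\<^sup>n\<close> reduce to powers of \<open>z\<close> or of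
  \<open>cnj z\<close>, and the real part does not distinguish the two kinds.
\<close>

lemma Re_poly_mult_cnj_on_circle:
  fixes p q :: "complex poly"
  shows "\<exists>r. \<forall>z. norm z = 1 \<longrightarrow> Re (poly p z * cnj (poly q z)) = Re (poly r z)"
proof (induction p q rule: poly_induct2)
  case 0
  show ?case by (intro exI[of _ 0]) simp
next
  case (pCons a p b q)
  then obtain r where r: "\<And>z. norm z = 1 \<Longrightarrow> Re (poly p z * cnj (poly q z)) = Re (poly r z)" by blast
  show ?case
  proof (intro exI allI impI)
    fix z :: complex assume z: "norm z = 1"
    have zz: "z * cnj z = 1" using z by (simp add: complex_norm_square[symmetric])
    have "poly (pCons a p) z * cnj (poly (pCons b q) z)
        = a * cnj b + a * cnj (z * poly q z) + cnj b * (z * poly p z) + (z * cnj z) * (poly p z * cnj (poly q z))"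
      by (simp add: algebra_simps)
    also have "Re \<dots> = Re (a * cnj b) + Re (cnj (a * cnj (z * poly q z))) + Re (cnj b * (z * poly p z)) + Re (poly r z)"
      unfolding zz using r[OF z] by (simp only: plus_complex.simps mult_1 complex_cnj_cancel_iff complex.sel cnj.simps)
    also have "\<dots> = Re (poly ([:a * cnj b:] + smult (cnj a) (pCons 0 q) + smult (cnj b) (pCons 0 p) + r) z)"
      by (simp add: algebra_simps)
    finally show "Re (poly (pCons a p) z * cnj (poly (pCons b q) z)) =
      Re (poly ([:a * cnj b:] + smult (cnj a) (pCons 0 q) + smult (cnj b) (pCons 0 p) + r) z)" .
  qed
qed

lemma Re_poly_mult_on_circle:
  fixes p q :: "complex poly"
  shows "\<exists>r. \<forall>z. norm z = 1 \<longrightarrow> Re (poly p z) * Re (poly q z) = Re (poly r z)"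
proof -
  obtain r where r: "\<And>z. norm z = 1 \<Longrightarrow> Re (poly p z * cnj (poly q z)) = Re (poly r z)"
    using Re_poly_mult_cnj_on_circle by blast
  have "Re (poly p z) * Re (poly q z) = Re (poly (smult (1/2) (p * q + r)) z)" if "norm z = 1" for z
    using r[OF that] by (simp add: field_simps)
  then show ?thesis by blast
qed

text \<open>
  Real parts of polynomials are closed under products on the circle and contain all real-linear functions;
  this brings them within reach of the Stone--Weierstrass theorem.
\<close>

lemma real_polynomial_function_eq_Re_poly_on_circle:
  assumes "real_polynomial_function (g :: complex \<Rightarrow> real)"
  shows "\<exists>p. \<forall>z. norm z = 1 \<longrightarrow> g z = Re (poly p z)"
  using assms
proof (induction rule: real_polynomial_function.induct)
  case (linear f)
  then interpret f: bounded_linear f .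
  have "f z = Re (poly [:0, Complex (f 1) (- f \<i>):] z)" for z
  proof -
    have "z = Re z *\<^sub>R 1 + Im z *\<^sub>R \<i>" by (simp add: complex_eq_iff)
    then have "f z = Re z * f 1 + Im z * f \<i>" by (metis f.add f.scaleR real_scaleR_def)
    then show ?thesis by simp
  qed
  then show ?case by blast
next
  case (const c)
  show ?case by (intro exI[of _ "[:of_real c:]"]) simp
next
  case (add f g)
  then obtain p q where "\<And>z. norm z = 1 \<Longrightarrow> f z = Re (poly p z)" "\<And>z. norm z = 1 \<Longrightarrow> g z = Re (poly q z)" by blast
  then show ?case by (intro exI[of _ "p + q"]) simp
next
  case (mult f g)
  then obtain p q where "\<And>z. norm z = 1 \<Longrightarrow> f z = Re (poly p z)" "\<And>z. norm z = 1 \<Longrightarrow> g z = Re (poly q z)" by blast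
  then show ?case using Re_poly_mult_on_circle[of p q] by auto
qed

lemma Re_poly_dense_on_circle:
  assumes "continuous_on (sphere 0 1) (f :: complex \<Rightarrow> real)" "0 < e"
  obtains p where "\<And>z. norm z = 1 \<Longrightarrow> \<bar>f z - Re (poly p z)\<bar> < e"
proof -
  obtain g where g: "real_polynomial_function g" "\<And>z. z \<in> sphere 0 1 \<Longrightarrow> \<bar>f z - g z\<bar> < e"
    using Stone_Weierstrass_real_polynomial_function[OF compact_sphere assms] by blast
  obtain p where "\<And>z. norm z = 1 \<Longrightarrow> g z = Re (poly p z)"
    using real_polynomial_function_eq_Re_poly_on_circle[OF g(1)] by blast
  with g(2) show ?thesis by (intro that[of p]) (auto simp: dist_norm)
qed

section \<open>The mean value inequality from a touching condition\<close>

text \<open>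
  If the conclusion failed, \<open>g - Re p + \<delta> |z|\<^sup>2\<close> would, for small \<open>\<delta> > 0\<close>, attain its maximum over the closed disc
  at an interior point \<open>z\<^sub>0\<close>.  There \<open>|z|\<^sup>2\<close> differs from \<open>|z - z\<^sub>0|\<^sup>2\<close> by the real part of an affine
  function, so \<open>g\<close> is touched from above by the real part of a polynomial minus \<open>\<delta> |z - z\<^sub>0|\<^sup>2\<close>.
\<close>

lemma maximum_principle_from_no_touching:
  fixes g :: "complex \<Rightarrow> ereal"
  assumes usc: "usc_on UNIV g" and fin: "\<And>z. g z \<noteq> \<infinity>"
    and no_touch: "\<And>z0 p \<delta> r. cmod z0 < 1 \<Longrightarrow> g z0 \<noteq> -\<infinity> \<Longrightarrow> 0 < \<delta> \<Longrightarrow> 0 < r \<Longrightarrow>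
      \<exists>z\<in>ball z0 r. g z0 + ereal (Re (poly p z) - Re (poly p z0) - \<delta> * (cmod (z - z0))\<^sup>2) < g z"
    and bd: "\<And>z. cmod z = 1 \<Longrightarrow> g z \<le> ereal (Re (poly p z))"
  shows "g 0 \<le> ereal (Re (poly p 0))"
proof (rule ccontr)
  assume "\<not> ?thesis"
  then obtain c where c: "g 0 = ereal c" "Re (poly p 0) < c"
    using fin[of 0] by (cases "g 0") auto
  define \<delta> where "\<delta> = (c - Re (poly p 0)) / 2"
  have \<delta>: "0 < \<delta>" using c by (simp add: \<delta>_def)
  define G where "G z = g z + ereal (\<delta> * (cmod z)\<^sup>2 - Re (poly p z))" for z
  have "usc_on UNIV (\<lambda>z. ereal (\<delta> * (cmod z)\<^sup>2 - Re (poly p z)))"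
    by (intro continuous_imp_usc continuous_intros)
  then have "usc_on UNIV G" unfolding G_def using usc fin by (intro usc_add) auto
  then obtain z0 where z0: "z0 \<in> cball 0 1" "\<And>z. z \<in> cball 0 1 \<Longrightarrow> G z \<le> G z0"
    using usc_attains_sup[of G "cball 0 1"] by auto
  have "ereal (2 * \<delta>) = G 0" using c by (simp add: G_def \<delta>_def)
  also have "\<dots> \<le> G z0" using z0(2)[of 0] by simp
  finally have G0: "ereal (2 * \<delta>) \<le> G z0" .
  then obtain v where v: "g z0 = ereal v" using fin[of z0] unfolding G_def by (cases "g z0") auto
  have lt1: "cmod z0 < 1"
  proof (rule ccontr)
    assume "\<not> cmod z0 < 1"
    then have "cmod z0 = 1" using z0(1) by simp
    then have "G z0 \<le> ereal \<delta>" using bd[of z0] v by (simp add: G_def)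
    with G0 have "ereal (2 * \<delta>) \<le> ereal \<delta>" by (rule order_trans)
    then show False using \<delta> by simp
  qed
  \<comment> \<open>The affine correction turns \<open>\<delta> |z|\<^sup>2\<close> into \<open>\<delta> |z - z\<^sub>0|\<^sup>2\<close> up to a constant.\<close>
  define q where "q = p - [:0, of_real (2 * \<delta>) * cnj z0:]"
  obtain z where z: "z \<in> ball z0 (1 - cmod z0)"
    "g z0 + ereal (Re (poly q z) - Re (poly q z0) - \<delta> * (cmod (z - z0))\<^sup>2) < g z"
    using no_touch[OF lt1, of \<delta> "1 - cmod z0" q] v \<delta> lt1 by auto
  have "cmod z \<le> cmod z0 + cmod (z - z0)" by (metis add.commute diff_add_cancel norm_triangle_ineq)
  then have "z \<in> cball 0 1" using z(1) by (simp add: dist_norm norm_minus_commute)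
  from z0(2)[OF this] have le: "g z + ereal (\<delta> * (cmod z)\<^sup>2 - Re (poly p z)) \<le> ereal (v + (\<delta> * (cmod z0)\<^sup>2 - Re (poly p z0)))"
    by (simp add: G_def v)
  have expand: "(cmod z)\<^sup>2 = (cmod (z - z0))\<^sup>2 + (cmod z0)\<^sup>2 + 2 * Re (cnj z0 * (z - z0))"
    unfolding cmod_power2 by (simp add: power2_eq_square algebra_simps)
  have "Re (poly q z) - Re (poly q z0) = Re (poly p z) - Re (poly p z0) - \<delta> * (2 * Re (cnj z0 * (z - z0)))"
    by (simp add: q_def algebra_simps)
  also have "2 * Re (cnj z0 * (z - z0)) = (cmod z)\<^sup>2 - (cmod (z - z0))\<^sup>2 - (cmod z0)\<^sup>2"
    using expand by simp
  finally have eq: "Re (poly q z) - Re (poly q z0) - \<delta> * (cmod (z - z0))\<^sup>2 =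
      Re (poly p z) - Re (poly p z0) - \<delta> * (cmod z)\<^sup>2 + \<delta> * (cmod z0)\<^sup>2"
    by (simp add: algebra_simps)
  from z(2) le show False unfolding eq v by (cases "g z") auto
qed

text \<open>
  Approximate \<open>g\<close> on the circle from above by continuous functions \<open>M - f\<^sub>n\<close>, and these by real parts of
  polynomials.  The maximum principle and the mean value property of the polynomials bound \<open>g 0\<close>
  by the mean of \<open>M - f\<^sub>n\<close>, and monotone convergence passes to the mean of \<open>g\<close>.
\<close>

lemma submean_from_no_touching:
  fixes g :: "complex \<Rightarrow> ereal"
  assumes usc: "usc_on UNIV g" and fin: "\<And>z. g z \<noteq> \<infinity>"
    and no_touch: "\<And>z0 p \<delta> r. cmod z0 < 1 \<Longrightarrow> g z0 \<noteq> -\<infinity> \<Longrightarrow> 0 < \<delta> \<Longrightarrow> 0 < r \<Longrightarrow>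
      \<exists>z\<in>ball z0 r. g z0 + ereal (Re (poly p z) - Re (poly p z0) - \<delta> * (cmod (z - z0))\<^sup>2) < g z"
  shows "g 0 \<le> arc_mean (\<lambda>\<theta>. g (cis \<theta>))"
proof (cases "g 0")
  case (real c)
  obtain M where M: "0 \<le> M" "\<And>z. z \<in> cball 0 1 \<Longrightarrow> g z \<le> ereal M"
    using usc_bounded_above_on_compact[OF usc fin compact_cball] by blast
  have cM: "c \<le> M" using M(2)[of 0] real by simp
  define k where "k z = max 0 (ereal M - g z)" for z
  have "open {z. a < k z}" for a
  proof (cases "a < 0")
    case True
    then have "{z. a < k z} = UNIV" by (auto simp: k_def less_max_iff_disj)
    then show ?thesis by simp
  next
    case False
    then have "a < k z \<longleftrightarrow> g z < ereal M - a" for z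
      by (cases a; cases "g z") (auto simp: k_def less_max_iff_disj fin)
    then show ?thesis using usc by (simp add: usc_on_UNIV_iff)
  qed
  then obtain f where f: "\<And>n. continuous_on UNIV (f n)" "\<And>n x. 0 \<le> f n x" "\<And>x. mono (\<lambda>n::nat. f n x)"
    "\<And>x. (SUP n. ereal (f n x)) = k x"
    using lsc_nonneg_eq_SUP_continuous[of k] by (auto simp: k_def)
  have cont_cis: "continuous_on A (\<lambda>\<theta>. f n (cis \<theta>))" for A n
    by (rule continuous_on_compose2[OF f(1)]) (auto intro!: continuous_intros)
  have kM: "k z = ereal M - g z" if "cmod z = 1" for z
    using M(2)[of z] that fin[of z] by (cases "g z") (auto simp: k_def)
  have g_le: "g z \<le> ereal (M - f n z)" if "cmod z = 1" for n z
  proof -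
    have "ereal (f n z) \<le> ereal M - g z"
      using f(4)[of z] kM[OF that] by (metis SUP_upper UNIV_I)
    then show ?thesis using fin[of z] by (cases "g z") auto
  qed
  have step: "ereal c \<le> arc_mean (\<lambda>\<theta>. ereal (M - f n (cis \<theta>)))" for n
  proof (rule ereal_le_epsilon2)
    fix e :: real assume e: "0 < e"
    \<comment> \<open>Approximating the function raised by \<open>e / 2\<close> to within \<open>e / 2\<close> keeps the polynomial above \<open>M - f n\<close>.\<close>
    have "continuous_on (sphere 0 1) (\<lambda>z. M - f n z + e / 2)"
      by (intro continuous_intros continuous_on_subset[OF f(1)]) auto
    then obtain p where p: "\<And>z. norm z = 1 \<Longrightarrow> \<bar>(M - f n z + e / 2) - Re (poly p z)\<bar> < e / 2"
      using Re_poly_dense_on_circle[of _ "e / 2"] e by (metis half_gt_zero)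
    have bd: "g z \<le> ereal (Re (poly p z))" if "cmod z = 1" for z
    proof -
      have "M - f n z \<le> Re (poly p z)" using p[OF that] by linarith
      then show ?thesis using g_le[OF that, of n] by (meson ereal_less_eq(3) order_trans)
    qed
    have "ereal c \<le> ereal (Re (poly p 0))"
      using maximum_principle_from_no_touching[OF usc fin no_touch bd] real by simp
    moreover have "arc_mean (\<lambda>\<theta>. ereal (Re (poly p (cis \<theta>)) - e)) = ereal (Re (poly p 0) - e)"
    proof -
      have "((\<lambda>\<theta>. Re (poly p (of_real 1 * cis \<theta>))) has_integral 2 * pi * Re (poly p 0)) {0..2*pi}"
        by (rule has_integral_circle_mean_value_Re[of _ 2]) (auto intro!: holomorphic_intros)
      moreover have "((\<lambda>\<theta>. e) has_integral (2*pi) * e) {0..2*pi}"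
        using has_integral_const_real[of e 0 "2*pi"] by simp
      ultimately have "((\<lambda>\<theta>. Re (poly p (of_real 1 * cis \<theta>)) - e) has_integral (2 * pi * Re (poly p 0) - 2*pi*e)) {0..2*pi}"
        by (rule has_integral_diff)
      moreover have "continuous_on {0..2*pi} (\<lambda>\<theta>. Re (poly p (of_real 1 * cis \<theta>)) - e)"
        by (intro continuous_intros)
      ultimately have "arc_mean (\<lambda>\<theta>. ereal (Re (poly p (of_real 1 * cis \<theta>)) - e)) =
          ereal ((2 * pi * Re (poly p 0) - 2*pi*e) / (2*pi))"
        by (rule arc_mean_continuous[rotated])
      then show ?thesis by (simp add: diff_divide_distrib)
    qed
    moreover have "arc_mean (\<lambda>\<theta>. ereal (Re (poly p (cis \<theta>)) - e)) \<le> arc_mean (\<lambda>\<theta>. ereal (M - f n (cis \<theta>)))"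
    proof (rule arc_mean_mono)
      fix \<theta> :: real
      show "ereal (Re (poly p (cis \<theta>)) - e) \<le> ereal (M - f n (cis \<theta>))"
        using p[of "cis \<theta>"] by (simp only: norm_cis ereal_less_eq) linarith
    qed
    ultimately show "ereal c \<le> arc_mean (\<lambda>\<theta>. ereal (M - f n (cis \<theta>))) + ereal e"
      by (cases "arc_mean (\<lambda>\<theta>. ereal (M - f n (cis \<theta>)))") auto
  qed
  have int_le: "(\<integral>\<^sup>+\<theta>\<in>{0..2*pi}. ennreal (f n (cis \<theta>)) \<partial>lborel) \<le> ennreal (2*pi*(M-c))" for n
  proof -
    have "(\<lambda>\<theta>. ereal (M - f n (cis \<theta>))) \<in> borel_measurable borel"
      by (intro borel_measurable_ereal borel_measurable_continuous_onI continuous_intros cont_cis)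
    from arc_mean_ge_iff[OF this M(1) _ cM] step[of n] f(2) show ?thesis by simp
  qed
  have meas: "(\<lambda>\<theta>. g (cis \<theta>)) \<in> borel_measurable borel"
    by (intro usc_borel_measurable usc_compose[OF usc] continuous_intros)
  have [measurable]: "(\<lambda>\<theta>. f n (cis \<theta>)) \<in> borel_measurable borel" for n
    by (intro borel_measurable_continuous_onI cont_cis)
  have sup: "e2ennreal (ereal M - g (cis \<theta>)) = (SUP n. ennreal (f n (cis \<theta>)))" for \<theta>
  proof -
    have "mono (\<lambda>n. ereal (f n (cis \<theta>)))" using f(3)[of "cis \<theta>"] by (auto simp: mono_def)
    then have "e2ennreal (SUP n. ereal (f n (cis \<theta>))) = (SUP n. e2ennreal (ereal (f n (cis \<theta>))))"
      using sup_continuousD[OF sup_continuous_e2ennreal[OF sup_continuous_id]] by blast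
    then show ?thesis using f(4)[of "cis \<theta>"] kM[of "cis \<theta>"] by simp
  qed
  have "(\<integral>\<^sup>+\<theta>\<in>{0..2*pi}. e2ennreal (ereal M - g (cis \<theta>)) \<partial>lborel)
      = (\<integral>\<^sup>+\<theta>. (SUP n. ennreal (f n (cis \<theta>)) * indicator {0..2*pi} \<theta>) \<partial>lborel)"
    unfolding sup by (intro nn_integral_cong) (auto split: split_indicator)
  also have "\<dots> = (SUP n. \<integral>\<^sup>+\<theta>\<in>{0..2*pi}. ennreal (f n (cis \<theta>)) \<partial>lborel)"
    using f(3) by (intro nn_integral_monotone_convergence_SUP)
      (auto simp: incseq_def le_fun_def mono_def intro!: mult_right_mono ennreal_leI)
  also have "\<dots> \<le> ennreal (2*pi*(M-c))" by (rule SUP_least) (rule int_le)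
  finally have "ereal c \<le> arc_mean (\<lambda>\<theta>. g (cis \<theta>))"
    using arc_mean_ge_iff[OF meas M(1) _ cM] M(2) by simp
  then show ?thesis using real by simp
qed (use fin in auto)

section \<open>Plurisubharmonic functions under projective maps\<close>

text \<open>
  Touching from above along a disc would give, by integration over the circle of radius \<open>\<rho>\<close>, a mean of \<open>u\<close> that
  is at most \<open>u w - \<kappa>\<close>, since \<open>Re H\<close> has mean \<open>Re (H 0) = 0\<close>.
\<close>

lemma psh_no_touching:
  fixes u :: "complex ^ 'n::finite \<Rightarrow> ereal"
  assumes u: "psh_on UNIV u" and ne: "u w \<noteq> -\<infinity>"
    and H: "H holomorphic_on ball 0 R" "H 0 = 0" and \<rho>: "0 < \<rho>" "\<rho> < R" and \<kappa>: "0 < \<kappa>"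
  shows "\<exists>\<theta>. u w + ereal (Re (H (of_real \<rho> * cis \<theta>)) - \<kappa>) < u (w + (of_real \<rho> * cis \<theta>) *s c)"
proof (rule ccontr)
  assume "\<not> ?thesis"
  then have le: "u (w + (of_real \<rho> * cis \<theta>) *s c) \<le> u w + ereal (Re (H (of_real \<rho> * cis \<theta>)) - \<kappa>)" for \<theta>
    by (simp add: not_less)
  obtain v where v: "u w = ereal v"
    using u ne by (cases "u w") (auto simp: psh_on_def)
  have cont: "continuous_on {0..2*pi} (\<lambda>\<theta>. Re (H (of_real \<rho> * cis \<theta>)))"
    by (intro continuous_intros continuous_on_compose2[OF holomorphic_on_imp_continuous_on[OF H(1)]])
       (use \<rho> in \<open>auto simp: norm_mult\<close>)
  have "((\<lambda>\<theta>. v + Re (H (of_real \<rho> * cis \<theta>)) - \<kappa>) has_integral (2 * pi * v + 2 * pi * Re (H 0) - 2 * pi * \<kappa>)) {0..2*pi}"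
    using has_integral_const_real[of v 0 "2*pi"] has_integral_const_real[of \<kappa> 0 "2*pi"]
    by (intro has_integral_diff has_integral_add has_integral_circle_mean_value_Re[OF H(1) \<rho>]) simp_all
  then have am: "arc_mean (\<lambda>\<theta>. ereal (v + Re (H (of_real \<rho> * cis \<theta>)) - \<kappa>)) = ereal (v - \<kappa>)"
    using arc_mean_continuous[of "\<lambda>\<theta>. v + Re (H (of_real \<rho> * cis \<theta>)) - \<kappa>"] cont H(2)
    by (simp add: continuous_intros diff_divide_distrib)
  have "u w \<le> circle_mean u w (of_real \<rho> *s c)"
    using u by (simp add: psh_on_def)
  also have "\<dots> = arc_mean (\<lambda>\<theta>. u (w + (of_real \<rho> * cis \<theta>) *s c))"
    by (simp add: circle_mean_eq_arc_mean vector_smult_assoc mult.commute)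
  also have "\<dots> \<le> arc_mean (\<lambda>\<theta>. ereal (v + Re (H (of_real \<rho> * cis \<theta>)) - \<kappa>))"
    using le v by (intro arc_mean_mono) (simp add: algebra_simps)
  finally show False using am v \<kappa> by simp
qed

text \<open>
  Near \<open>z\<^sub>0\<close> the map \<open>w\<close> traces the complex line \<open>\<eta> \<mapsto> w z\<^sub>0 + \<eta> c\<close> with \<open>c = B - b w z\<^sub>0\<close>, where
  \<open>z - z\<^sub>0 = s \<eta> = \<eta> d(z\<^sub>0) / (1 - b \<eta>)\<close>.  In the variable \<open>\<eta>\<close> the test function is again the real part of a
  holomorphic function minus a positive quantity on small circles; the logarithmic term contributes
  \<open>t log |d z| = t log |d z\<^sub>0| - t Re Ln (1 - b \<eta>)\<close>.
\<close>

lemma psh_projective_no_touching: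
  fixes u :: "complex ^ 'n::finite \<Rightarrow> ereal" and A B :: "complex ^ 'n" and a b z0 :: complex and t :: real
  defines "d \<equiv> \<lambda>z. a + z * b"
  defines "w \<equiv> \<lambda>z. inverse (d z) *s (A + z *s B)"
  assumes u: "psh_on UNIV u" and d0: "d z0 \<noteq> 0" and ne: "u (w z0) \<noteq> -\<infinity>" and pos: "0 < \<delta>" "0 < r"
  shows "\<exists>z\<in>ball z0 r. d z \<noteq> 0 \<and>
    u (w z0) + ereal (t * ln (cmod (d z0))) + ereal (Re (poly p z) - Re (poly p z0) - \<delta> * (cmod (z - z0))\<^sup>2)
      < u (w z) + ereal (t * ln (cmod (d z)))"
proof -
  define s where "s \<eta> = \<eta> * d z0 / (1 - b * \<eta>)" for \<eta>
  \<comment> \<open>The first bound keeps \<open>|b \<eta>| < 1/2\<close>, the second keeps \<open>z\<^sub>0 + s \<eta>\<close> in the ball of radius \<open>r\<close>.\<close>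
  define R where "R = min (1 / (2 * (cmod b + 1))) (r / (2 * (cmod (d z0) + 1)))"
  have R: "0 < R" using pos unfolding R_def by (simp add: add_nonneg_pos)
  have bR: "cmod b * R \<le> 1 / 2"
  proof -
    have "cmod b * R \<le> cmod b * (1 / (2 * (cmod b + 1)))" by (intro mult_left_mono) (auto simp: R_def)
    also have "\<dots> = (cmod b / (cmod b + 1)) / 2" by simp
    also have "\<dots> \<le> 1 / 2" by (intro divide_right_mono) (auto simp: divide_le_eq_1 add_nonneg_pos)
    finally show ?thesis .
  qed
  have dR: "2 * R * cmod (d z0) < r"
  proof -
    have "2 * R * cmod (d z0) \<le> 2 * (r / (2 * (cmod (d z0) + 1))) * cmod (d z0)"
      by (intro mult_right_mono mult_left_mono) (auto simp: R_def)
    also have "\<dots> = r * (cmod (d z0) / (cmod (d z0) + 1))" by (simp del: distrib_left_numeral)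
    also have "\<dots> < r * 1" using pos by (intro mult_strict_left_mono) (auto simp: divide_less_eq_1 add_nonneg_pos)
    finally show ?thesis by simp
  qed
  have b\<eta>: "cmod (b * \<eta>) < 1 / 2" if "cmod \<eta> < R" for \<eta>
  proof (cases "b = 0")
    case False
    then have "cmod b * cmod \<eta> < cmod b * R" using that by (intro mult_strict_left_mono) auto
    then show ?thesis using bR by (simp add: norm_mult)
  qed simp
  have Re1: "0 < Re (1 - b * \<eta>)" if "cmod \<eta> < R" for \<eta>
    using b\<eta>[OF that] abs_Re_le_cmod[of "b * \<eta>"] by simp
  have den: "1 / 2 < cmod (1 - b * \<eta>)" "cmod (1 - b * \<eta>) < 2" "1 - b * \<eta> \<noteq> 0" if "cmod \<eta> < R" for \<eta>
    using b\<eta>[OF that] norm_triangle_ineq2[of 1 "b * \<eta>"] norm_triangle_ineq4[of 1 "b * \<eta>"] Re1[OF that]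
    by auto
  define H where "H \<eta> = poly p (z0 + s \<eta>) - poly p z0 + of_real t * Ln (1 - b * \<eta>)" for \<eta>
  have Hol: "H holomorphic_on ball 0 R"
    unfolding H_def s_def using den(3) Re1
    by (intro holomorphic_intros) (auto simp: complex_nonpos_Reals_iff dest: Re1)
  have H0: "H 0 = 0" by (simp add: H_def s_def)
  define \<rho> where "\<rho> = R / 2"
  have \<rho>: "0 < \<rho>" "\<rho> < R" using R by (auto simp: \<rho>_def)
  \<comment> \<open>A lower bound of \<open>\<delta> |s \<eta>|\<^sup>2\<close> on the circle \<open>|\<eta>| = \<rho>\<close>, because \<open>|1 - b \<eta>| < 2\<close>.\<close>
  define \<kappa> where "\<kappa> = \<delta> * (\<rho> * cmod (d z0) / 2)\<^sup>2"
  have \<kappa>: "0 < \<kappa>" using pos \<rho> d0 by (simp add: \<kappa>_def)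
  obtain \<theta> where \<theta>: "u (w z0) + ereal (Re (H (of_real \<rho> * cis \<theta>)) - \<kappa>)
      < u (w z0 + (of_real \<rho> * cis \<theta>) *s (B - b *s w z0))"
    using psh_no_touching[OF u ne Hol H0 \<rho> \<kappa>] by blast
  define \<eta> where "\<eta> = of_real \<rho> * cis \<theta>"
  have \<eta>: "cmod \<eta> = \<rho>" using \<rho> by (simp add: \<eta>_def norm_mult)
  then have \<eta>R: "cmod \<eta> < R" using \<rho> by simp
  note den = den[OF \<eta>R]
  define z where "z = z0 + s \<eta>"
  have dz: "d z = d z0 / (1 - b * \<eta>)"
  proof -
    have "d z = d z0 + s \<eta> * b" by (simp add: d_def z_def algebra_simps)
    then show ?thesis using den(3) by (simp add: s_def field_simps)
  qed
  have dz0: "d z \<noteq> 0" using dz d0 den(3) by simp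
  have wz: "w z = w z0 + \<eta> *s (B - b *s w z0)"
  proof -
    define q where "q = (1 - b * \<eta>) / d z0"
    have q: "q * d z0 = 1 - b * \<eta>" "q * s \<eta> = \<eta>"
      using d0 den(3) by (simp_all add: s_def q_def)
    have "A + z *s B = d z0 *s w z0 + s \<eta> *s B"
      using d0 by (simp add: w_def z_def vec_eq_iff algebra_simps)
    moreover have "inverse (d z) = q" using dz by (simp add: q_def)
    moreover have "w z = inverse (d z) *s (A + z *s B)" by (simp add: w_def)
    ultimately have "w z = q *s (d z0 *s w z0 + s \<eta> *s B)" by (simp only:)
    also have "\<dots> = (q * d z0) *s w z0 + (q * s \<eta>) *s B"
      by (simp add: vec_eq_iff algebra_simps)
    also have "\<dots> = w z0 + \<eta> *s (B - b *s w z0)"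
      unfolding q by (simp add: vec_eq_iff algebra_simps)
    finally show ?thesis .
  qed
  have cs: "cmod (s \<eta>) = \<rho> * cmod (d z0) / cmod (1 - b * \<eta>)"
    by (simp add: s_def norm_mult norm_divide \<eta>)
  have s: "\<rho> * cmod (d z0) / 2 \<le> cmod (s \<eta>)"
    unfolding cs using den \<rho> by (intro divide_left_mono mult_nonneg_nonneg mult_pos_pos) auto
  have "\<rho> * cmod (d z0) / cmod (1 - b * \<eta>) \<le> \<rho> * cmod (d z0) / (1 / 2)"
    using den \<rho> by (intro divide_left_mono mult_nonneg_nonneg mult_pos_pos) auto
  also have "\<dots> = R * cmod (d z0)" by (simp add: \<rho>_def)
  also have "\<dots> < r"
  proof -
    have "0 \<le> R * cmod (d z0)" using R by simp
    then show ?thesis using dR by linarith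
  qed
  finally have "cmod (s \<eta>) < r" unfolding cs .
  then have zb: "z \<in> ball z0 r" by (simp add: z_def dist_norm)
  have \<kappa>s: "\<kappa> \<le> \<delta> * (cmod (z - z0))\<^sup>2"
    unfolding \<kappa>_def z_def using s pos \<rho> by (intro mult_left_mono power_mono) auto
  have ln: "ln (cmod (d z)) = ln (cmod (d z0)) - ln (cmod (1 - b * \<eta>))"
    using dz d0 den(3) by (simp add: norm_divide ln_div)
  have ReH: "Re (H \<eta>) = Re (poly p z) - Re (poly p z0) + t * ln (cmod (1 - b * \<eta>))"
    using den(3) by (simp add: H_def z_def Re_Ln)
  obtain v where v: "u (w z0) = ereal v"
    using u ne by (cases "u (w z0)") (auto simp: psh_on_def)
  have "ereal (v + Re (H \<eta>) - \<kappa>) < u (w z)"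
    using \<theta> unfolding \<eta>_def[symmetric] wz[symmetric] v by (simp add: add_diff_eq)
  then have "ereal (v + t * ln (cmod (d z0)) + (Re (poly p z) - Re (poly p z0) - \<delta> * (cmod (z - z0))\<^sup>2))
      < u (w z) + ereal (t * ln (cmod (d z)))"
    using \<kappa>s unfolding ReH ln by (cases "u (w z)") (auto simp: algebra_simps)
  then show ?thesis using zb dz0 v by (intro bexI[of _ z]) auto
qed

text \<open>
  This is the removal of the singularity along \<open>z\<^sub>k = 0\<close>.  With \<open>D\<close> an upper bound of \<open>|z\<^sub>k|\<close> on the disc, the
  perturbation \<open>\<epsilon> log (|z\<^sub>k| / D)\<close> is at most \<open>0\<close> on the disc and \<open>-\<infinity>\<close> where the line meets the hyperplane, so it
  rules out touching there without increasing the mean; at the centre it disappears with \<open>\<epsilon>\<close>.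
\<close>

lemma psh_projective_submean:
  fixes u F :: "complex ^ 'n::finite \<Rightarrow> ereal" and k :: 'n
  defines "w \<equiv> \<lambda>z. inverse (z $ k) *s (\<chi> i. if i = k then 1 else z $ i)"
  assumes u: "psh_on UNIV u" and usc: "usc_on UNIV F" and fin: "\<And>z. F z \<noteq> \<infinity>"
    and F: "\<And>z. z $ k \<noteq> 0 \<Longrightarrow> F z = u (w z) + ereal (ln (cmod (z $ k)))"
    and a: "a $ k \<noteq> 0"
  shows "F a \<le> circle_mean F a b"
proof -
  define A where "A = (\<chi> i. if i = k then 1 else a $ i)"
  define B where "B = (\<chi> i. if i = k then 0 else b $ i)"
  define d where "d z = a $ k + z * b $ k" for z
  define D where "D = cmod (a $ k) + cmod (b $ k)"
  have D: "0 < D" using a by (simp add: D_def add_pos_nonneg)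
  have wl: "w (a + z *s b) = inverse (d z) *s (A + z *s B)" for z
    by (simp add: w_def d_def A_def B_def vec_eq_iff algebra_simps)
  have Fl: "F (a + z *s b) = u (inverse (d z) *s (A + z *s B)) + ereal (ln (cmod (d z)))" if "d z \<noteq> 0" for z
    using F[of "a + z *s b"] that by (simp add: wl) (simp add: d_def)
  have cont_d: "continuous_on S d" for S unfolding d_def by (intro continuous_intros)
  have main: "F a + ereal (\<epsilon> * ln (cmod (a $ k) / D)) \<le> circle_mean F a b" if \<epsilon>: "0 < \<epsilon>" for \<epsilon>
  proof -
    define L where "L z = (if d z = 0 then -\<infinity> else ereal (\<epsilon> * ln (cmod (d z) / D)))" for z
    define g where "g z = F (a + z *s b) + L z" for z
    have uscL: "usc_on UNIV L"
    proof (subst usc_on_UNIV_ereal_iff)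
      show "L x \<noteq> \<infinity>" for x by (simp add: L_def)
      have "L z < ereal c \<longleftrightarrow> cmod (d z) < D * exp (c / \<epsilon>)" for z c
      proof (cases "d z = 0")
        case False
        then have "\<epsilon> * ln (cmod (d z) / D) < c \<longleftrightarrow> ln (cmod (d z) / D) < c / \<epsilon>"
          using \<epsilon> by (simp add: field_simps)
        also have "\<dots> \<longleftrightarrow> cmod (d z) / D < exp (c / \<epsilon>)"
          using False D by (metis divide_pos_pos exp_less_cancel_iff exp_ln zero_less_norm_iff)
        also have "\<dots> \<longleftrightarrow> cmod (d z) < D * exp (c / \<epsilon>)"
          using D by (simp add: field_simps)
        finally show ?thesis using False by (simp add: L_def)
      qed (use D in \<open>simp add: L_def\<close>)
      then show "\<forall>r. open {x. L x < ereal r}"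
        by (auto intro!: open_Collect_less continuous_intros cont_d)
    qed
    have uscF: "usc_on UNIV (\<lambda>z. F (a + z *s b))"
    proof (rule usc_compose[OF usc])
      show "continuous_on UNIV (\<lambda>z. a + z *s b)"
        unfolding vector_scalar_mult_def by (intro continuous_intros)
    qed
    have uscg: "usc_on UNIV g"
      unfolding g_def by (rule usc_add[OF uscF fin uscL]) (simp add: L_def)
    have fing: "g z \<noteq> \<infinity>" for z using fin by (simp add: g_def L_def)
    have g_eq: "g z = u (inverse (d z) *s (A + z *s B)) + ereal ((1 + \<epsilon>) * ln (cmod (d z))) + ereal (- \<epsilon> * ln D)"
      if "d z \<noteq> 0" for z
      unfolding g_def using that D
      by (cases "u (inverse (d z) *s (A + z *s B))") (auto simp: Fl L_def ln_div algebra_simps)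
    have "g 0 \<le> arc_mean (\<lambda>\<theta>. g (cis \<theta>))"
    proof (rule submean_from_no_touching[OF uscg fing])
      fix z0 p and \<delta> r :: real
      assume z0: "g z0 \<noteq> -\<infinity>" and pos: "0 < \<delta>" "0 < r"
      have d0: "d z0 \<noteq> 0" using z0 fin by (auto simp: g_def L_def)
      have ne: "u (inverse (d z0) *s (A + z0 *s B)) \<noteq> -\<infinity>" using z0 g_eq[OF d0] by auto
      obtain z where z: "z \<in> ball z0 r" "d z \<noteq> 0"
        "u (inverse (d z0) *s (A + z0 *s B)) + ereal ((1 + \<epsilon>) * ln (cmod (d z0)))
           + ereal (Re (poly p z) - Re (poly p z0) - \<delta> * (cmod (z - z0))\<^sup>2)
         < u (inverse (d z) *s (A + z *s B)) + ereal ((1 + \<epsilon>) * ln (cmod (d z)))"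
        using psh_projective_no_touching[OF u d0[unfolded d_def] ne[unfolded d_def] pos] unfolding d_def by blast
      have "g z0 + ereal (Re (poly p z) - Re (poly p z0) - \<delta> * (cmod (z - z0))\<^sup>2) < g z"
        using z(3) unfolding g_eq[OF d0] g_eq[OF z(2)]
        by (cases "u (inverse (d z0) *s (A + z0 *s B))"; cases "u (inverse (d z) *s (A + z *s B))") auto
      then show "\<exists>z\<in>ball z0 r. g z0 + ereal (Re (poly p z) - Re (poly p z0) - \<delta> * (cmod (z - z0))\<^sup>2) < g z"
        using z(1) by blast
    qed
    also have "\<dots> \<le> arc_mean (\<lambda>\<theta>. F (a + cis \<theta> *s b))"
    proof (rule arc_mean_mono)
      fix \<theta> :: real
      have "cmod (d (cis \<theta>)) \<le> D"
        unfolding d_def D_def using norm_triangle_ineq[of "a $ k" "cis \<theta> * b $ k"] by (simp add: norm_mult)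
      then have "L (cis \<theta>) \<le> 0"
        using D \<epsilon> by (auto simp: L_def mult_le_0_iff)
      then show "g (cis \<theta>) \<le> F (a + cis \<theta> *s b)"
        unfolding g_def using add_left_mono[of "L (cis \<theta>)" 0 "F (a + cis \<theta> *s b)"] by simp
    qed
    finally show ?thesis using a by (simp add: g_def L_def d_def circle_mean_eq_arc_mean)
  qed
  show ?thesis
  proof (cases "F a")
    case (real v)
    show ?thesis
    proof (rule ereal_le_epsilon2)
      fix e :: real assume e: "0 < e"
      define l where "l = ln (cmod (a $ k) / D)"
      \<comment> \<open>The loss at the centre for \<open>\<epsilon> = e / (1 + |l|)\<close> is at most \<open>e\<close>.\<close>
      have "e / (1 + \<bar>l\<bar>) * l \<ge> - e"
      proof -
        have "e * (- l) \<le> e * (1 + \<bar>l\<bar>)" using e by (intro mult_left_mono) auto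
        then show ?thesis using e by (simp add: field_simps)
      qed
      moreover have "F a + ereal (e / (1 + \<bar>l\<bar>) * l) \<le> circle_mean F a b"
        using main[of "e / (1 + \<bar>l\<bar>)"] e unfolding l_def by (simp add: add_pos_nonneg)
      ultimately show "F a \<le> circle_mean F a b + ereal e"
        using real by (cases "circle_mean F a b") auto
    qed
  qed (use fin in auto)
qed

section \<open>Limits of the mean value inequality\<close>

text \<open>
  Fatou's lemma for the deficits \<open>M - f\<close> along the circles around \<open>an n\<close>, where \<open>M\<close> bounds \<open>f\<close> on a ball that contains all
  these circles.
\<close>

lemma circle_mean_ge_limit:
  fixes f :: "complex ^ 'n::finite \<Rightarrow> ereal"
  assumes usc: "usc_on UNIV f" and fin: "\<And>z. f z \<noteq> \<infinity>"
    and an: "an \<longlonglongrightarrow> a" and cn: "cn \<longlonglongrightarrow> c"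
    and le: "\<And>n. ereal (cn n) \<le> circle_mean f (an n) b"
  shows "ereal c \<le> circle_mean f a b"
proof -
  have "bounded (insert a (range an))"
    using convergent_imp_bounded[OF an] by simp
  then obtain B where B: "\<And>x. x \<in> insert a (range an) \<Longrightarrow> norm x \<le> B"
    unfolding bounded_iff by blast
  define S where "S = cball (0::complex ^ 'n) (B + norm b)"
  have nb: "norm (cis \<theta> *s b) = norm b" for \<theta>
    by (simp add: norm_vec_def L2_set_def norm_mult)
  have inS: "x + cis \<theta> *s b \<in> S" if "x \<in> insert a (range an)" for x \<theta>
    using B[OF that] norm_triangle_ineq[of x "cis \<theta> *s b"] by (simp add: S_def nb)
  obtain M0 where M0: "0 \<le> M0" "\<And>z. z \<in> S \<Longrightarrow> f z \<le> ereal M0"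
    using usc_bounded_above_on_compact[OF usc fin, of S] by (auto simp: S_def)
  have "bounded (insert c (range cn))"
    using convergent_imp_bounded[OF cn] by simp
  then obtain C where C: "\<And>x. x \<in> insert c (range cn) \<Longrightarrow> norm x \<le> C"
    unfolding bounded_iff by blast
  define M where "M = max M0 C"
  have M: "0 \<le> M" and Mf: "\<And>z. z \<in> S \<Longrightarrow> f z \<le> ereal M" and cM: "c \<le> M" "\<And>n. cn n \<le> M"
    using M0 C by (fastforce simp: M_def le_max_iff_disj abs_le_iff)+
  define k where "k z = e2ennreal (ereal M - f z)" for z
  have meas: "(\<lambda>\<theta>. f (x + cis \<theta> *s b)) \<in> borel_measurable borel" for x
    unfolding vector_scalar_mult_def
    by (intro usc_borel_measurable usc_compose[OF usc] continuous_intros)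
  have [measurable]: "(\<lambda>\<theta>. k (x + cis \<theta> *s b)) \<in> borel_measurable borel" for x
    unfolding k_def using meas[of x] by measurable
  \<comment> \<open>Lower semicontinuity of the deficit supplies the integrand of Fatou's lemma.\<close>
  have opk: "open {z. y < k z}" for y
  proof -
    have "y < k z \<longleftrightarrow> f z < ereal M - enn2ereal y" for z
    proof -
      have "y < k z \<longleftrightarrow> enn2ereal y < ereal M - f z"
      proof (cases "0 \<le> ereal M - f z")
        case True
        then show ?thesis by (simp add: k_def less_ennreal.rep_eq enn2ereal_e2ennreal)
      next
        case False
        moreover from False have "\<not> enn2ereal y < ereal M - f z"
          using enn2ereal_nonneg[of y] by (meson le_less_trans less_imp_le)
        ultimately show ?thesis by (simp add: k_def e2ennreal_neg)
      qed
      also have "\<dots> \<longleftrightarrow> f z < ereal M - enn2ereal y"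
        using fin[of z] enn2ereal_nonneg[of y] by (cases "f z"; cases "enn2ereal y") auto
      finally show ?thesis .
    qed
    then show ?thesis using usc by (simp add: usc_on_UNIV_iff)
  qed
  have "(\<integral>\<^sup>+\<theta>\<in>{0..2*pi}. k (a + cis \<theta> *s b) \<partial>lborel)
     \<le> (\<integral>\<^sup>+\<theta>. liminf (\<lambda>n. k (an n + cis \<theta> *s b) * indicator {0..2*pi} \<theta>) \<partial>lborel)"
  proof (intro nn_integral_mono)
    fix \<theta> :: real
    have "(\<lambda>n. an n + cis \<theta> *s b) \<longlonglongrightarrow> a + cis \<theta> *s b"
      by (intro tendsto_intros an)
    then have "\<forall>\<^sub>F n in sequentially. y < k (an n + cis \<theta> *s b)" if "y < k (a + cis \<theta> *s b)" for y
      using topological_tendstoD[OF _ opk[of y]] that by simp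
    then have "k (a + cis \<theta> *s b) \<le> liminf (\<lambda>n. k (an n + cis \<theta> *s b))"
      unfolding le_Liminf_iff by blast
    then show "k (a + cis \<theta> *s b) * indicator {0..2*pi} \<theta> \<le> liminf (\<lambda>n. k (an n + cis \<theta> *s b) * indicator {0..2*pi} \<theta>)"
      by (auto split: split_indicator)
  qed
  also have "\<dots> \<le> liminf (\<lambda>n. \<integral>\<^sup>+\<theta>\<in>{0..2*pi}. k (an n + cis \<theta> *s b) \<partial>lborel)"
    by (intro nn_integral_liminf) measurable
  also have "\<dots> \<le> liminf (\<lambda>n. ennreal (2*pi*(M - cn n)))"
  proof (intro Liminf_mono always_eventually allI)
    fix n
    show "(\<integral>\<^sup>+\<theta>\<in>{0..2*pi}. k (an n + cis \<theta> *s b) \<partial>lborel) \<le> ennreal (2*pi*(M - cn n))"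
      using arc_mean_ge_iff[OF meas M _ cM(2), of "an n"] Mf inS le[of n]
      by (simp add: circle_mean_eq_arc_mean k_def)
  qed
  also have "\<dots> = ennreal (2*pi*(M - c))"
    by (intro lim_imp_Liminf tendsto_intros cn) simp
  finally show ?thesis
    using arc_mean_ge_iff[OF meas M _ cM(1), of a] Mf inS
    by (simp add: circle_mean_eq_arc_mean k_def)
qed

section \<open>Integrability against the Fubini--Study volume\<close>

lemma nn_integral_lborel_translate:
  fixes f :: "'a::euclidean_space \<Rightarrow> ennreal"
  assumes [measurable]: "f \<in> borel_measurable borel"
  shows "(\<integral>\<^sup>+x. f (t + x) \<partial>lborel) = (\<integral>\<^sup>+x. f x \<partial>lborel)"
proof -
  have "(\<integral>\<^sup>+x. f x \<partial>lborel) = (\<integral>\<^sup>+x. f x \<partial>distr lborel borel ((+) t))"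
    by (simp add: lborel_distr_plus)
  also have "\<dots> = (\<integral>\<^sup>+x. f (t + x) \<partial>lborel)"
    by (subst nn_integral_distr) auto
  finally show ?thesis by simp
qed

lemma nn_integral_lborel_reflect:
  fixes f :: "'a::euclidean_space \<Rightarrow> ennreal"
  assumes [measurable]: "f \<in> borel_measurable borel"
  shows "(\<integral>\<^sup>+x. f (t - x) \<partial>lborel) = (\<integral>\<^sup>+x. f x \<partial>lborel)"
proof -
  have "(\<integral>\<^sup>+x. f x \<partial>lborel) = (\<integral>\<^sup>+x. f x \<partial>density (distr lborel borel (\<lambda>x. t + (-1) *\<^sub>R x)) (\<lambda>_. ennreal (\<bar>-1\<bar> ^ DIM('a))))"
    by (subst lborel_affine[of "-1" t]) auto
  also have "\<dots> = (\<integral>\<^sup>+x. f (t - x) \<partial>lborel)"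
    by (subst nn_integral_density) (auto simp: nn_integral_distr)
  finally show ?thesis by simp
qed

text \<open>
  Invariance comes from the uniqueness argument for translation invariant measures: with \<open>B\<close>
  the unit ball, which \<open>T\<close> preserves, Tonelli's theorem and translations in both variables transform
  \<open>(\<integral> f \<circ> T) \<lambda>(B)\<close> into \<open>(\<integral> f) \<lambda>(B)\<close>, and \<open>0 < \<lambda>(B) < \<infinity>\<close>.
\<close>

lemma nn_integral_lborel_orthogonal:
  fixes f :: "'a::euclidean_space \<Rightarrow> ennreal" and T :: "'a \<Rightarrow> 'a"
  assumes T: "orthogonal_transformation T" and f: "f \<in> borel_measurable borel"
  shows "(\<integral>\<^sup>+x. f (T x) \<partial>lborel) = (\<integral>\<^sup>+x. f x \<partial>lborel)"
proof -
  have lin: "linear T" using T by (rule orthogonal_transformation_linear)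
  have [measurable]: "T \<in> borel_measurable borel"
    using lin by (intro borel_measurable_continuous_onI linear_continuous_on linear_conv_bounded_linear[THEN iffD1])
  have nT: "norm (T x) = norm x" for x using T by (rule orthogonal_transformation_norm)
  obtain S where S: "\<And>y. T (S y) = y"
    using orthogonal_transformation_surj[OF T] by (metis surjD)
  define B where "B = ball (0::'a) 1"
  have [measurable]: "B \<in> sets borel" by (simp add: B_def)
  have TB: "T x \<in> B \<longleftrightarrow> x \<in> B" for x by (simp add: B_def nT)
  have Bpos: "emeasure lborel B \<noteq> 0" "emeasure lborel B \<noteq> \<infinity>"
    unfolding B_def using unit_ball_vol_pos[of "real DIM('a)"]
    by (auto simp: emeasure_ball less_top[symmetric] simp del: unit_ball_vol_pos)
  note [measurable] = f
  have "(\<integral>\<^sup>+x. f (T x) \<partial>lborel) * emeasure lborel B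
      = (\<integral>\<^sup>+x. f (T x) * (\<integral>\<^sup>+y. indicator B y \<partial>lborel) \<partial>lborel)"
    by (simp add: nn_integral_multc)
  also have "\<dots> = (\<integral>\<^sup>+x. f (T x) * (\<integral>\<^sup>+y. indicator B (T x + y) \<partial>lborel) \<partial>lborel)"
    by (simp add: nn_integral_lborel_translate[of "indicator B"] del: nn_integral_indicator)
  also have "\<dots> = (\<integral>\<^sup>+x. \<integral>\<^sup>+y. f (T x) * indicator B (T x + y) \<partial>lborel \<partial>lborel)"
    by (simp add: nn_integral_cmult)
  also have "\<dots> = (\<integral>\<^sup>+y. \<integral>\<^sup>+x. f (T x) * indicator B (T x + y) \<partial>lborel \<partial>lborel)"
    by (rule lborel_pair.Fubini') measurable
  also have "\<dots> = (\<integral>\<^sup>+y. \<integral>\<^sup>+x. f (T x - y) * indicator B (T x) \<partial>lborel \<partial>lborel)"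
  proof (rule nn_integral_cong)
    fix y :: 'a
    have "(\<integral>\<^sup>+x. f (T x - y) * indicator B (T x) \<partial>lborel)
        = (\<integral>\<^sup>+x. f (T (S y + x) - y) * indicator B (T (S y + x)) \<partial>lborel)"
      by (rule nn_integral_lborel_translate[symmetric]) measurable
    then show "(\<integral>\<^sup>+x. f (T x) * indicator B (T x + y) \<partial>lborel) = (\<integral>\<^sup>+x. f (T x - y) * indicator B (T x) \<partial>lborel)"
      by (simp add: linear_add[OF lin] S add.commute)
  qed
  also have "\<dots> = (\<integral>\<^sup>+x. \<integral>\<^sup>+y. f (T x - y) * indicator B (T x) \<partial>lborel \<partial>lborel)"
    by (rule lborel_pair.Fubini') measurable
  also have "\<dots> = (\<integral>\<^sup>+x. (\<integral>\<^sup>+y. f y \<partial>lborel) * indicator B x \<partial>lborel)"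
  proof (rule nn_integral_cong)
    fix x :: 'a
    have "indicator B (T x) = (indicator B x :: ennreal)" by (simp add: indicator_def TB)
    then show "(\<integral>\<^sup>+y. f (T x - y) * indicator B (T x) \<partial>lborel) = (\<integral>\<^sup>+y. f y \<partial>lborel) * indicator B x"
      by (simp add: nn_integral_multc nn_integral_lborel_reflect)
  qed
  also have "\<dots> = (\<integral>\<^sup>+y. f y \<partial>lborel) * emeasure lborel B"
    by (simp add: nn_integral_cmult)
  finally show ?thesis
    using Bpos ennreal_mult_divide_eq[of "emeasure lborel B"] by (metis infinity_ennreal_def)
qed

lemma orthogonal_transformation_cis:
  "orthogonal_transformation (\<lambda>z :: complex ^ 'n::finite. cis \<theta> *s z)"
  unfolding orthogonal_transformation
proof
  show "linear (\<lambda>z :: complex ^ 'n. cis \<theta> *s z)"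
    by (rule linearI) (simp_all add: vec_eq_iff algebra_simps)
qed (simp add: norm_vec_def L2_set_def norm_mult)

text \<open>
  The real dimension is \<open>2 N\<close>, so on the dyadic ball of radius \<open>2\<^sup>n\<^sup>+\<^sup>1\<close> the volume is of order \<open>4\<^sup>n\<^sup>N\<close>, while the
  integrand is at most of order \<open>2\<^sup>n / 4\<^sup>n\<^sup>(\<^sup>N\<^sup>+\<^sup>1\<^sup>)\<close> outside the ball of half that radius.  The products form a geometric
  series of ratio \<open>1/2\<close>.
\<close>

lemma nn_integral_radial_weight_finite:
  "(\<integral>\<^sup>+z. ennreal ((1 + norm (z :: complex ^ 'n::finite)) / (1 + (norm z)\<^sup>2) ^ (CARD('n) + 1)) \<partial>lborel) < \<infinity>"
proof -
  let ?N = "CARD('n)"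
  define c where "c n = 2 ^ (n + 2) / ((4::real) ^ n) ^ (?N + 1)" for n :: nat
  define V where "V = unit_ball_vol (real (2 * ?N))"
  have V: "0 \<le> V" by (simp add: V_def)
  let ?B = "\<lambda>n::nat. ball (0 :: complex ^ 'n) (2 ^ (n + 1))"
  have c0: "0 \<le> c n" for n by (simp add: c_def)
  have pt: "ennreal ((1 + norm z) / (1 + (norm z)\<^sup>2) ^ (?N + 1)) \<le> (\<Sum>n. ennreal (c n) * indicator (?B n) z)" for z
  proof -
    have "\<exists>n. norm z < 2 ^ (n + 1) \<and> (1 + norm z) / (1 + (norm z)\<^sup>2) ^ (?N + 1) \<le> c n"
    proof (cases "norm z < 1")
      case True
      have "(1 + norm z) / (1 + (norm z)\<^sup>2) ^ (?N + 1) \<le> (1 + norm z) / 1"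
        by (intro divide_left_mono one_le_power) (auto intro!: mult_pos_pos zero_less_power add_pos_nonneg)
      then show ?thesis using True by (intro exI[of _ 0]) (simp add: c_def)
    next
      case False
      define n where "n = nat \<lfloor>log 2 (norm z)\<rfloor>"
      have pos: "0 < norm z" using False by (meson less_le_trans not_less zero_less_one)
      \<comment> \<open>\<open>n\<close> is the dyadic scale: \<open>2\<^sup>n \<le> \<parallel>z\<parallel> < 2\<^sup>n\<^sup>+\<^sup>1\<close>.\<close>
      have "0 \<le> log 2 (norm z)" using False by (subst zero_le_log_cancel_iff) (use pos in auto)
      then have n: "real n \<le> log 2 (norm z)" "log 2 (norm z) < real n + 1"
        unfolding n_def by linarith+
      have l: "2 ^ n \<le> norm z" using n(1) pos by (simp add: le_log_iff powr_realpow)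
      have u: "norm z < 2 ^ (n + 1)"
        using n(2) pos by (simp add: log_less_iff powr_add powr_realpow)
      have "4 ^ n = ((2::real) ^ n)\<^sup>2" by (simp add: power2_eq_square power_mult_distrib[symmetric])
      also have "\<dots> \<le> 1 + (norm z)\<^sup>2" using power_mono[OF l, of 2] zero_le_power[of "2::real" n] by linarith
      finally have q: "4 ^ n \<le> 1 + (norm z)\<^sup>2" .
      have "(1::real) \<le> 2 ^ n" "(2::real) ^ (n + 2) = 4 * 2 ^ n" "(2::real) ^ (n + 1) = 2 * 2 ^ n" by simp_all
      then have "1 + norm z \<le> 2 ^ (n + 2)" using u by linarith
      then have "(1 + norm z) / (1 + (norm z)\<^sup>2) ^ (?N + 1) \<le> c n"
        unfolding c_def using q by (intro frac_le power_mono) auto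
      with u show ?thesis by blast
    qed
    then obtain n where n: "norm z < 2 ^ (n + 1)" "(1 + norm z) / (1 + (norm z)\<^sup>2) ^ (?N + 1) \<le> c n" by blast
    have "ennreal ((1 + norm z) / (1 + (norm z)\<^sup>2) ^ (?N + 1)) \<le> ennreal (c n) * indicator (?B n) z"
      using n by (simp add: ennreal_leI)
    also have "\<dots> \<le> (\<Sum>i. ennreal (c i) * indicator (?B i) z)"
    proof -
      define g where "g = (\<lambda>i. ennreal (c i) * indicator (?B i) z)"
      have "sum g {n} \<le> suminf g" by (rule sum_le_suminf) auto
      then have "g n \<le> suminf g" by simp
      then show ?thesis unfolding g_def .
    qed
    finally show ?thesis .
  qed
  have val: "ennreal (c n) * emeasure lborel (?B n) = ennreal (V * 4 ^ (?N + 1) * (1 / 2) ^ n)" for n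
  proof -
    have "emeasure lborel (?B n) = ennreal (V * (2 ^ (n + 1)) ^ (2 * ?N))"
      by (subst emeasure_ball) (simp_all add: V_def mult.commute)
    then have "ennreal (c n) * emeasure lborel (?B n) = ennreal (c n * (V * (2 ^ (n + 1)) ^ (2 * ?N)))"
      using c0 V by (simp add: ennreal_mult)
    also have "c n * (V * (2 ^ (n + 1)) ^ (2 * ?N)) = V * 4 ^ (?N + 1) * (1 / 2) ^ n"
    proof -
      define t X where "t = (2::real) ^ n" and "X = ((4::real) ^ n) ^ ?N"
      have t: "0 < t" "0 < X" by (simp_all add: t_def X_def)
      have sq: "(4::real) ^ n = t * t" by (simp add: t_def flip: power_mult_distrib)
      have "((2::real) ^ (n + 1))\<^sup>2 = 4 * 4 ^ n" by (simp add: sq t_def power2_eq_square)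
      then have "((2::real) ^ (n + 1)) ^ (2 * ?N) = 4 ^ ?N * X"
        by (simp only: power_mult power_mult_distrib X_def)
      moreover have "c n = 4 * t / (X * (t * t))"
        by (simp add: c_def t_def X_def sq)
      moreover have "(1 / 2) ^ n = 1 / t" by (simp add: t_def power_one_over)
      ultimately show ?thesis using t by (simp add: field_simps)
    qed
    finally show ?thesis .
  qed
  have "(\<integral>\<^sup>+z. ennreal ((1 + norm (z :: complex ^ 'n)) / (1 + (norm z)\<^sup>2) ^ (?N + 1)) \<partial>lborel)
      \<le> (\<integral>\<^sup>+z. (\<Sum>n. ennreal (c n) * indicator (?B n) z) \<partial>lborel)"
    by (intro nn_integral_mono pt)
  also have "\<dots> = (\<Sum>n. ennreal (V * 4 ^ (?N + 1) * (1 / 2) ^ n))"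
  proof -
    have [measurable]: "?B n \<in> sets borel" for n by simp
    have "(\<integral>\<^sup>+z. (\<Sum>n. ennreal (c n) * indicator (?B n) z) \<partial>lborel)
        = (\<Sum>n. \<integral>\<^sup>+z. ennreal (c n) * indicator (?B n) z \<partial>lborel)"
      by (rule nn_integral_suminf) measurable
    moreover have "(\<integral>\<^sup>+z. ennreal (c n) * indicator (?B n) z \<partial>lborel) = ennreal (V * 4 ^ (?N + 1) * (1 / 2) ^ n)" for n
      unfolding val[symmetric] by (rule nn_integral_cmult_indicator) simp
    ultimately show ?thesis by (simp only:)
  qed
  also have "\<dots> < \<infinity>"
  proof -
    have "summable (\<lambda>n. V * 4 ^ (?N + 1) * (1 / 2) ^ n :: real)"
      by (intro summable_mult summable_geometric) simp
    then show ?thesis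
      using V by (subst suminf_ennreal2) auto
  qed
  finally show ?thesis .
qed

text \<open>
  Move the origin to \<open>a\<close>, at the cost of a constant factor \<open>C\<close> in the density.  The density \<open>\<rho>\<close> is constant on the circles
  \<open>cis \<theta> z\<close>, so by rotation invariance the integral equals its average over \<open>\<theta>\<close>; by Tonelli's theorem the
  average may be taken first, and there the mean value inequality around \<open>a\<close> leaves a bound of linear growth
  in \<open>\<parallel>z\<parallel>\<close>.
\<close>

lemma lelong_deficit_integrable:
  fixes u :: "complex ^ 'n::finite \<Rightarrow> ereal"
  assumes u: "psh_on UNIV u" and a: "u a \<noteq> -\<infinity>" and M: "0 \<le> M"
    and le: "\<And>z. u z \<le> ereal (M + 1/2 * ln (1 + (norm z)\<^sup>2))"
  shows "(\<integral>\<^sup>+z. e2ennreal (ereal (M + 1/2 * ln (1 + (norm z)\<^sup>2)) - u z)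
      * ennreal (1 / (1 + (norm z)\<^sup>2) ^ (CARD('n) + 1)) \<partial>lborel) < \<infinity>"
proof -
  let ?N = "CARD('n)"
  define P where "P = (\<lambda>z :: complex ^ 'n. M + 1/2 * ln (1 + (norm z)\<^sup>2))"
  define k where "k z = e2ennreal (ereal (P z) - u z)" for z
  define \<rho> where "\<rho> = (\<lambda>z :: complex ^ 'n. 1 / (1 + (norm z)\<^sup>2) ^ (?N + 1))"
  obtain c where c: "u a = ereal c" using u a by (cases "u a") (auto simp: psh_on_def)
  have pos: "0 < 1 + (norm z)\<^sup>2" for z :: "complex ^ 'n" by (simp add: add_pos_nonneg)
  have usc: "usc_on UNIV u" using u by (simp add: psh_on_def)
  have um[measurable]: "u \<in> borel_measurable borel" by (rule usc_borel_measurable[OF usc])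
  have [measurable]: "P \<in> borel_measurable borel" "\<rho> \<in> borel_measurable borel"
    unfolding P_def \<rho>_def by measurable
  have [measurable]: "k \<in> borel_measurable borel" unfolding k_def by measurable
  have \<rho>0: "0 \<le> \<rho> z" for z by (simp add: \<rho>_def)
  define C where "C = (2 * (1 + (norm a)\<^sup>2)) ^ (?N + 1)"
  have C0: "0 \<le> C" by (simp add: C_def)
  have \<rho>C: "\<rho> (a + z) \<le> C * \<rho> z" for z
  proof -
    have "norm z \<le> norm (a + z) + norm a"
      using norm_triangle_ineq4[of "a + z" a] by simp
    then have "(norm z)\<^sup>2 \<le> (norm (a + z) + norm a)\<^sup>2" by (intro power_mono) auto
    also have "\<dots> \<le> 2 * (norm (a + z))\<^sup>2 + 2 * (norm a)\<^sup>2"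
      using zero_le_power2[of "norm (a + z) - norm a"] unfolding power2_diff power2_sum by linarith
    finally have f: "(norm z)\<^sup>2 \<le> 2 * (norm (a + z))\<^sup>2 + 2 * (norm a)\<^sup>2" .
    have "0 \<le> (norm a)\<^sup>2 * (norm (a + z))\<^sup>2" by (intro mult_nonneg_nonneg zero_le_power2)
    moreover have "2 * (1 + (norm a)\<^sup>2) * (1 + (norm (a + z))\<^sup>2)
        = 2 + 2 * (norm a)\<^sup>2 + 2 * (norm (a + z))\<^sup>2 + 2 * ((norm a)\<^sup>2 * (norm (a + z))\<^sup>2)"
      by (simp add: algebra_simps)
    ultimately have "1 + (norm z)\<^sup>2 \<le> 2 * (1 + (norm a)\<^sup>2) * (1 + (norm (a + z))\<^sup>2)"
      using f by linarith
    then have "(1 + (norm z)\<^sup>2) ^ (?N + 1) \<le> (2 * (1 + (norm a)\<^sup>2) * (1 + (norm (a + z))\<^sup>2)) ^ (?N + 1)"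
      by (rule power_mono) (use pos[of z] in simp)
    also have "\<dots> = C * (1 + (norm (a + z))\<^sup>2) ^ (?N + 1)"
      unfolding C_def by (rule power_mult_distrib)
    finally have "(1 + (norm z)\<^sup>2) ^ (?N + 1) \<le> C * (1 + (norm (a + z))\<^sup>2) ^ (?N + 1)" .
    moreover have "0 < (1 + (norm z)\<^sup>2) ^ (?N + 1)" "0 < (1 + (norm (a + z))\<^sup>2) ^ (?N + 1)"
      using pos[of z] pos[of "a + z"] by (simp_all only: zero_less_power)
    moreover have "1 / y \<le> C * (1 / x)" if "x \<le> C * y" "0 < x" "0 < y" for x y :: real
      using that by (simp add: field_simps)
    ultimately show ?thesis unfolding \<rho>_def by blast
  qed
  \<comment> \<open>A bound for \<open>P\<close> on the circle through \<open>a + z\<close> that does not depend on the angle; it uses \<open>1/2 log (1 + x\<^sup>2) \<le> x\<close>.\<close>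
  define r where "r z = M + norm a + norm z" for z :: "complex ^ 'n"
  have Pr: "P (a + cis \<theta> *s z) \<le> r z" for \<theta> z
  proof -
    let ?x = "norm (a + cis \<theta> *s z)"
    have "1 + ?x\<^sup>2 \<le> (1 + ?x)\<^sup>2" by (simp add: power2_eq_square algebra_simps)
    then have "ln (1 + ?x\<^sup>2) \<le> ln ((1 + ?x)\<^sup>2)" by (intro ln_mono pos) auto
    also have "\<dots> = 2 * ln (1 + ?x)" by (simp add: ln_realpow add_pos_nonneg)
    also have "\<dots> \<le> 2 * ?x" using ln_add_one_self_le_self[of ?x] by simp
    finally have "P (a + cis \<theta> *s z) \<le> M + ?x" by (simp add: P_def)
    also have "?x \<le> norm a + norm z"
      using norm_triangle_ineq[of a "cis \<theta> *s z"] orthogonal_transformation_norm[OF orthogonal_transformation_cis[of \<theta>], of z] by simp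
    finally show ?thesis by (simp add: r_def)
  qed
  have inner: "(\<integral>\<^sup>+\<theta>\<in>{0..2*pi}. k (a + cis \<theta> *s z) \<partial>lborel) \<le> ennreal (2 * pi * (r z - c))" for z
  proof -
    have r0: "0 \<le> r z" using M by (simp add: r_def)
    have le_r: "u (a + cis \<theta> *s z) \<le> ereal (r z)" for \<theta>
      using le[of "a + cis \<theta> *s z"] Pr[of \<theta> z] unfolding P_def by (meson ereal_less_eq(3) order_trans)
    have "P a \<le> r z" using Pr[of 0 0] unfolding r_def by (simp add: P_def add_increasing2)
    then have cr: "c \<le> r z" using le[of a] c unfolding P_def by simp
    have meas: "(\<lambda>\<theta>. u (a + cis \<theta> *s z)) \<in> borel_measurable borel"
      unfolding vector_scalar_mult_def
      by (intro usc_borel_measurable usc_compose[OF usc] continuous_intros)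
    have "ereal c \<le> arc_mean (\<lambda>\<theta>. u (a + cis \<theta> *s z))"
      using u by (simp add: psh_on_def circle_mean_eq_arc_mean flip: c)
    then have "(\<integral>\<^sup>+\<theta>\<in>{0..2*pi}. e2ennreal (ereal (r z) - u (a + cis \<theta> *s z)) \<partial>lborel) \<le> ennreal (2 * pi * (r z - c))"
      using arc_mean_ge_iff[OF meas r0 le_r cr] by blast
    moreover have "(\<integral>\<^sup>+\<theta>\<in>{0..2*pi}. k (a + cis \<theta> *s z) \<partial>lborel)
       \<le> (\<integral>\<^sup>+\<theta>\<in>{0..2*pi}. e2ennreal (ereal (r z) - u (a + cis \<theta> *s z)) \<partial>lborel)"
      unfolding k_def using Pr[of _ z]
      by (intro nn_integral_mono mult_right_mono e2ennreal_mono ereal_minus_mono) auto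
    ultimately show ?thesis by (rule order_trans[rotated])
  qed
  define J where "J = (\<integral>\<^sup>+z. k (a + z) * ennreal (\<rho> z) \<partial>lborel)"
  have rot: "J = (\<integral>\<^sup>+z. k (a + cis \<theta> *s z) * ennreal (\<rho> z) \<partial>lborel)" for \<theta>
  proof -
    have "\<rho> (cis \<theta> *s z) = \<rho> z" for z
      using orthogonal_transformation_norm[OF orthogonal_transformation_cis[of \<theta>], of z] by (simp add: \<rho>_def)
    then show ?thesis
      using nn_integral_lborel_orthogonal[OF orthogonal_transformation_cis[of \<theta>], of "\<lambda>z. k (a + z) * ennreal (\<rho> z)"]
      by (simp add: J_def)
  qed
  have mpair: "(\<lambda>(\<theta>, z). k (a + cis \<theta> *s z) * ennreal (\<rho> z) * indicator {0..2*pi} \<theta>)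
      \<in> borel_measurable (lborel \<Otimes>\<^sub>M lborel)"
  proof -
    have "(\<lambda>x :: real \<times> (complex ^ 'n). a + cis (fst x) *s snd x) \<in> borel_measurable borel"
      unfolding vector_scalar_mult_def
      by (intro borel_measurable_continuous_onI continuous_intros)
    then have [measurable]: "(\<lambda>x :: real \<times> (complex ^ 'n). a + cis (fst x) *s snd x) \<in> borel \<Otimes>\<^sub>M borel \<rightarrow>\<^sub>M borel"
      by (simp add: borel_prod)
    show ?thesis unfolding split_beta' by measurable
  qed
  have "J * ennreal (2 * pi) = (\<integral>\<^sup>+\<theta>. J * indicator {0..2*pi} \<theta> \<partial>lborel)"
    by (simp add: nn_integral_cmult_indicator)
  also have "\<dots> = (\<integral>\<^sup>+\<theta>. \<integral>\<^sup>+z. k (a + cis \<theta> *s z) * ennreal (\<rho> z) * indicator {0..2*pi} \<theta> \<partial>lborel \<partial>lborel)"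
  proof (rule nn_integral_cong)
    fix \<theta> :: real
    have "J * indicator {0..2*pi} \<theta> = (\<integral>\<^sup>+z. k (a + cis \<theta> *s z) * ennreal (\<rho> z) \<partial>lborel) * indicator {0..2*pi} \<theta>"
      using rot[of \<theta>] by simp
    also have "\<dots> = (\<integral>\<^sup>+z. k (a + cis \<theta> *s z) * ennreal (\<rho> z) * indicator {0..2*pi} \<theta> \<partial>lborel)"
      by (cases "\<theta> \<in> {0..2*pi}") auto
    finally show "J * indicator {0..2*pi} \<theta> = \<dots>" .
  qed
  also have "\<dots> = (\<integral>\<^sup>+z. \<integral>\<^sup>+\<theta>. k (a + cis \<theta> *s z) * ennreal (\<rho> z) * indicator {0..2*pi} \<theta> \<partial>lborel \<partial>lborel)"
    by (rule lborel_pair.Fubini'[symmetric, OF mpair])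
  also have "\<dots> \<le> (\<integral>\<^sup>+z. ennreal (2 * pi * (1 + M + norm a + \<bar>c\<bar>)) * ennreal ((1 + norm (z :: complex ^ 'n)) / (1 + (norm z)\<^sup>2) ^ (?N + 1)) \<partial>lborel)"
  proof (rule nn_integral_mono)
    fix z :: "complex ^ 'n"
    have [measurable]: "(\<lambda>\<theta>. k (a + cis \<theta> *s z)) \<in> borel_measurable borel"
    proof -
      have [measurable]: "(\<lambda>\<theta>. a + cis \<theta> *s z) \<in> borel_measurable borel"
        unfolding vector_scalar_mult_def by (intro borel_measurable_continuous_onI continuous_intros)
      show ?thesis by measurable
    qed
    have "(\<integral>\<^sup>+\<theta>. k (a + cis \<theta> *s z) * ennreal (\<rho> z) * indicator {0..2*pi} \<theta> \<partial>lborel)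
        = (\<integral>\<^sup>+\<theta>. ennreal (\<rho> z) * (k (a + cis \<theta> *s z) * indicator {0..2*pi} \<theta>) \<partial>lborel)"
      by (intro nn_integral_cong) (simp add: mult_ac)
    also have "\<dots> = ennreal (\<rho> z) * (\<integral>\<^sup>+\<theta>\<in>{0..2*pi}. k (a + cis \<theta> *s z) \<partial>lborel)"
      by (rule nn_integral_cmult) measurable
    also have "\<dots> \<le> ennreal (\<rho> z) * ennreal (2 * pi * (r z - c))"
      by (intro mult_left_mono inner) auto
    also have "\<dots> \<le> ennreal (\<rho> z) * ennreal (2 * pi * ((1 + M + norm a + \<bar>c\<bar>) * (1 + norm z)))"
    proof -
      have "r z - c \<le> (1 + M + norm a + \<bar>c\<bar>) * (1 + norm z)"
      proof -
        define K where "K = M + norm a + \<bar>c\<bar>"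
        have "0 \<le> K * norm z" using M by (simp add: K_def)
        moreover have "(1 + M + norm a + \<bar>c\<bar>) * (1 + norm z) = 1 + K + norm z + K * norm z"
          by (simp add: K_def algebra_simps)
        ultimately show ?thesis unfolding r_def K_def by linarith
      qed
      then show ?thesis by (intro mult_left_mono ennreal_leI) auto
    qed
    also have "\<dots> = ennreal (\<rho> z * (2 * pi * ((1 + M + norm a + \<bar>c\<bar>) * (1 + norm z))))"
      using \<rho>0[of z] M by (subst ennreal_mult) auto
    also have "\<dots> = ennreal (2 * pi * (1 + M + norm a + \<bar>c\<bar>) * ((1 + norm z) * \<rho> z))"
      by (simp only: mult_ac)
    also have "\<dots> = ennreal (2 * pi * (1 + M + norm a + \<bar>c\<bar>)) * ennreal ((1 + norm z) * \<rho> z)"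
      using \<rho>0[of z] M by (intro ennreal_mult) auto
    finally show "(\<integral>\<^sup>+\<theta>. k (a + cis \<theta> *s z) * ennreal (\<rho> z) * indicator {0..2*pi} \<theta> \<partial>lborel)
      \<le> ennreal (2 * pi * (1 + M + norm a + \<bar>c\<bar>)) * ennreal ((1 + norm z) / (1 + (norm z)\<^sup>2) ^ (?N + 1))"
      by (simp add: \<rho>_def)
  qed
  also have "\<dots> < \<infinity>"
    using nn_integral_radial_weight_finite[where 'n = 'n]
    by (subst nn_integral_cmult) (auto simp: ennreal_mult_less_top)
  finally have "J * ennreal (2 * pi) < \<infinity>" .
  then have J: "J < \<infinity>" by (auto simp: ennreal_mult_less_top)
  have "(\<integral>\<^sup>+z. k z * ennreal (\<rho> z) \<partial>lborel) = (\<integral>\<^sup>+z. k (a + z) * ennreal (\<rho> (a + z)) \<partial>lborel)"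
    by (rule nn_integral_lborel_translate[symmetric]) measurable
  also have "\<dots> \<le> (\<integral>\<^sup>+z. ennreal C * (k (a + z) * ennreal (\<rho> z)) \<partial>lborel)"
  proof (rule nn_integral_mono)
    fix z
    have "ennreal (\<rho> (a + z)) \<le> ennreal C * ennreal (\<rho> z)"
      using \<rho>C[of z] C0 \<rho>0[of z] by (simp add: ennreal_leI flip: ennreal_mult)
    then have "k (a + z) * ennreal (\<rho> (a + z)) \<le> k (a + z) * (ennreal C * ennreal (\<rho> z))"
      by (rule mult_left_mono) simp
    then show "k (a + z) * ennreal (\<rho> (a + z)) \<le> ennreal C * (k (a + z) * ennreal (\<rho> z))"
      by (simp only: mult_ac)
  qed
  also have "\<dots> = ennreal C * J"
    unfolding J_def by (rule nn_integral_cmult) measurable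
  also have "\<dots> < \<infinity>" using J by (simp add: ennreal_mult_less_top)
  finally show ?thesis by (simp add: k_def \<rho>_def P_def)
qed

section \<open>Charts of projective space\<close>

text \<open>
  The representative vector that \<open>chart j\<close> projects.
\<close>

definition hom_coords :: "'n option \<Rightarrow> complex ^ 'n \<Rightarrow> complex ^ ('n::finite) option" where
  "hom_coords j z = (\<chi> i. if i = j then 1 else case i of Some k \<Rightarrow> z $ k | None \<Rightarrow> z $ the j)"

text \<open>
  The inverse of \<open>chart j\<close>, as a function of homogeneous coordinates; \<open>affine_coords\<close> is the case \<open>j = None\<close>.
\<close>

definition aff_coords :: "'n option \<Rightarrow> complex ^ 'n option \<Rightarrow> complex ^ ('n::finite)" where
  "aff_coords j Z = (\<chi> k. if j = Some k then Z $ None / Z $ j else Z $ Some k / Z $ j)"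

lemma chart_eq_proj: "chart j z = proj (hom_coords j z)"
  by (simp add: chart_def hom_coords_def)

lemma hom_coords_nth_self [simp]: "hom_coords j z $ j = 1"
  by (simp add: hom_coords_def)

lemma hom_coords_nonzero [simp]: "hom_coords j z \<noteq> 0"
  by (metis hom_coords_nth_self zero_index zero_neq_one)

lemma hom_coords_aff_coords: "Z $ j \<noteq> 0 \<Longrightarrow> hom_coords j (aff_coords j Z) = inverse (Z $ j) *s Z"
  by (auto simp: hom_coords_def aff_coords_def vec_eq_iff divide_inverse split: option.splits)

lemma aff_coords_scale: "c \<noteq> 0 \<Longrightarrow> aff_coords j (c *s Z) = aff_coords j Z"
  by (simp add: aff_coords_def vec_eq_iff)

lemma aff_coords_hom_coords: "aff_coords j (hom_coords j z) = z"
  by (cases j) (auto simp: aff_coords_def hom_coords_def vec_eq_iff)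

lemma chart_aff_coords:
  assumes "Z $ j \<noteq> 0"
  shows "chart j (aff_coords j Z) = proj Z"
proof -
  have "Z \<noteq> 0" using assms by auto
  then have "proj Z = proj (hom_coords j (aff_coords j Z))"
    using assms by (subst proj_eq_iff) (auto simp: hom_coords_aff_coords intro!: exI[of _ "inverse (Z $ j)"])
  then show ?thesis by (simp add: chart_eq_proj)
qed

lemma proj_eq_chart_iff:
  assumes "Z \<noteq> 0"
  shows "proj Z = chart j z \<longleftrightarrow> Z $ j \<noteq> 0 \<and> aff_coords j Z = z"
proof
  assume "proj Z = chart j z"
  then obtain c where c: "c \<noteq> 0" "Z = c *s hom_coords j z"
    unfolding chart_eq_proj using proj_eq_iff[of "hom_coords j z" Z] assms by auto
  then show "Z $ j \<noteq> 0 \<and> aff_coords j Z = z"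
    by (simp add: aff_coords_scale aff_coords_hom_coords)
qed (metis chart_aff_coords)

lemma inj_chart: "inj (chart j)"
  by (rule injI) (metis aff_coords_hom_coords chart_eq_proj hom_coords_nonzero proj_eq_chart_iff)

lemma continuous_on_hom_coords: "continuous_on S (hom_coords j)"
proof -
  have "continuous_on S (\<lambda>z. if i = j then 1 else case i of Some k \<Rightarrow> z $ k | None \<Rightarrow> z $ the j)" for i
    by (cases "i = j"; cases i) (auto intro!: continuous_intros)
  then show ?thesis unfolding hom_coords_def by (intro continuous_on_vec_lambda) 
qed

lemma continuous_on_proj: "continuous_on (- {0}) (proj :: _ \<Rightarrow> ('n::finite) cproj)"
  unfolding continuous_on_open_invariant
proof (intro allI impI)
  fix B :: "'n cproj set" assume "open B"
  then have "open {Z. Z \<noteq> 0 \<and> proj Z \<in> B}" by (simp add: open_cproj_def)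
  then show "\<exists>A. open A \<and> A \<inter> - {0} = proj -` B \<inter> - {0}"
    by (intro exI[of _ "{Z. Z \<noteq> 0 \<and> proj Z \<in> B}"]) auto
qed

lemma continuous_on_chart: "continuous_on S (chart j)"
  unfolding chart_eq_proj[abs_def]
  by (rule continuous_on_compose2[OF continuous_on_proj continuous_on_hom_coords]) auto

lemma open_chart_image:
  fixes B :: "(complex ^ 'n::finite) set"
  assumes "open B"
  shows "open (chart j ` B)"
proof -
  have "{Z. Z \<noteq> 0 \<and> proj Z \<in> chart j ` B} = {Z. Z $ j \<noteq> 0} \<inter> aff_coords j -` B"
  proof (intro set_eqI)
    fix Z :: "complex ^ 'n option"
    show "Z \<in> {Z. Z \<noteq> 0 \<and> proj Z \<in> chart j ` B} \<longleftrightarrow> Z \<in> {Z. Z $ j \<noteq> 0} \<inter> aff_coords j -` B"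
      using proj_eq_chart_iff[of Z j] by (cases "Z = 0") (simp_all add: image_iff)
  qed
  moreover have "open ({Z. Z $ j \<noteq> 0} \<inter> aff_coords j -` B)"
  proof (rule continuous_open_preimage[OF _ _ assms])
    have "continuous_on {Z. Z $ j \<noteq> 0} (\<lambda>Z :: complex ^ 'n option. if j = Some k then Z $ None / Z $ j else Z $ Some k / Z $ j)" for k
    proof -
      have "continuous_on {Z. Z $ j \<noteq> 0} (\<lambda>Z :: complex ^ 'n option. Z $ i / Z $ j)" for i
        by (rule continuous_on_divide) (auto intro!: continuous_intros)
      then show ?thesis by (cases "j = Some k") simp_all
    qed
    then show "continuous_on {Z. Z $ j \<noteq> 0} (aff_coords j)"
      unfolding aff_coords_def by (intro continuous_on_vec_lambda)
    show "open {Z :: complex ^ 'n option. Z $ j \<noteq> 0}"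
      by (intro open_Collect_neq continuous_intros)
  qed
  ultimately show ?thesis by (simp add: open_cproj_def)
qed

lemma compact_cproj: "compact (UNIV :: ('n::finite) cproj set)"
proof -
  have "UNIV = proj ` sphere (0 :: complex ^ 'n option) 1"
  proof (intro equalityI subsetI)
    fix p :: "'n cproj"
    obtain Z where Z: "Z \<noteq> 0" "p = proj Z" by (rule proj_surj)
    define W where "W = complex_of_real (inverse (norm Z)) *s Z"
    have "W = inverse (norm Z) *\<^sub>R Z" by (simp add: W_def vec_eq_iff scaleR_conv_of_real[where 'a = complex])
    then have "norm W = 1" "W \<noteq> 0" using Z by auto
    moreover have "proj Z = proj W"
      using Z \<open>W \<noteq> 0\<close> by (subst proj_eq_iff) (auto simp: W_def intro!: exI[of _ "of_real (inverse (norm Z))"])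
    ultimately show "p \<in> proj ` sphere 0 1" using Z by (auto simp: image_iff)
  qed auto
  moreover have "compact (proj ` sphere (0 :: complex ^ 'n option) 1)"
    by (intro compact_continuous_image continuous_on_subset[OF continuous_on_proj]) auto
  ultimately show ?thesis by simp
qed

text \<open>
  This form of the potential is what makes the change of charts transparent: two potentials differ by
  \<open>log |Z\<^sub>i / Z\<^sub>j|\<close>.
\<close>

lemma fs_potential_proj:
  assumes "Z $ j \<noteq> 0"
  shows "fs_potential j (proj Z) = ln (norm Z / cmod (Z $ j))"
proof -
  have Z: "Z \<noteq> 0" using assms by auto
  then have "cproj_rel Z Z" by (auto simp: cproj_rel_def intro!: exI[of _ 1])
  then have "fs_potential j (proj Z) = 1/2 * ln (1 + (\<Sum>k\<in>UNIV - {j}. (cmod (Z $ k / Z $ j))\<^sup>2))"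
    by (simp add: proj_def fs_potential.abs_eq)
  also have "1 + (\<Sum>k\<in>UNIV - {j}. (cmod (Z $ k / Z $ j))\<^sup>2) = (\<Sum>k\<in>UNIV. (cmod (Z $ k / Z $ j))\<^sup>2)"
    using assms by (subst (2) sum.remove[of _ j]) auto
  also have "\<dots> = (norm Z / cmod (Z $ j))\<^sup>2"
    by (simp add: norm_divide power_divide norm_vec_def L2_set_def sum_nonneg sum_divide_distrib)
  finally show ?thesis using Z assms by (simp add: ln_realpow)
qed

lemma norm_hom_coords_None: "(norm (hom_coords None z))\<^sup>2 = 1 + (norm z)\<^sup>2"
  by (simp add: norm_vec_def L2_set_def sum_nonneg UNIV_option_conv sum.reindex hom_coords_def)

lemma fs_potential_chart: "fs_potential j (chart j z) = ln (norm (hom_coords j z))"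
  unfolding chart_eq_proj by (subst fs_potential_proj) auto

lemma ln_norm_hom_coords_None: "ln (norm (hom_coords None z)) = 1/2 * ln (1 + (norm z)\<^sup>2)"
  unfolding norm_hom_coords_None[symmetric] by (simp add: ln_realpow)

lemma continuous_on_ln_norm_hom_coords: "continuous_on S (\<lambda>z. ln (norm (hom_coords j z)))"
  by (intro continuous_intros continuous_on_hom_coords) auto

section \<open>The correspondence with the Lelong class\<close>

text \<open>
  The value of the extension at \<open>p\<close> is the infimum, over open neighbourhoods of \<open>p\<close>, of the supremum of \<open>G\<close>.  It is upper
  semicontinuous by construction, agrees with \<open>G\<close> in the chart because \<open>G\<close> is itself upper semicontinuous and the chart
  is open, and every value is approached from within the chart, as the last property records.
\<close>

lemma usc_extension:
  fixes G :: "complex ^ 'n::finite \<Rightarrow> ereal" and M :: real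
  assumes G: "usc_on UNIV G" "\<And>z. G z \<le> ereal M"
  obtains v where "usc_on UNIV v" "\<And>p. v p \<le> ereal M" "\<And>z. v (chart None z) = G z"
    "\<And>p c U. c < v p \<Longrightarrow> open U \<Longrightarrow> p \<in> U \<Longrightarrow> \<exists>z. chart None z \<in> U \<and> c < G z"
proof -
  define v where "v p = (INF U\<in>{U. open U \<and> p \<in> U}. SUP z\<in>{z. chart None z \<in> U}. G z)" for p
  have v_le: "v p \<le> (SUP z\<in>{z. chart None z \<in> U}. G z)" if "open U" "p \<in> U" for p U
    unfolding v_def using that by (intro INF_lower) auto
  show ?thesis
  proof (rule that[of v])
    show "usc_on UNIV v"
      unfolding usc_on_UNIV_iff
    proof
      fix c show "open {p. v p < c}"
      proof (subst open_subopen, rule ballI)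
        fix p assume "p \<in> {p. v p < c}"
        then obtain U where U: "open U" "p \<in> U" "(SUP z\<in>{z. chart None z \<in> U}. G z) < c"
          unfolding v_def by (auto simp: INF_less_iff)
        then have "U \<subseteq> {p. v p < c}" using v_le by (auto intro: le_less_trans)
        with U show "\<exists>T. open T \<and> p \<in> T \<and> T \<subseteq> {p. v p < c}" by blast
      qed
    qed
    show "v p \<le> ereal M" for p
      by (rule order_trans[OF v_le[of UNIV p]]) (auto intro: SUP_least G(2))
    show "v (chart None z) = G z" for z
    proof (rule antisym)
      show "v (chart None z) \<le> G z"
      proof (rule dense_ge)
        fix c assume c: "G z < c"
        define U where "U = chart None ` {y. G y < c}"
        have "open U" "chart None z \<in> U"
          using G(1) c by (auto simp: U_def usc_on_UNIV_iff intro!: open_chart_image)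
        then have "v (chart None z) \<le> (SUP z\<in>{z. chart None z \<in> U}. G z)" by (rule v_le)
        also have "\<dots> \<le> c"
          by (rule SUP_least) (auto simp: U_def dest!: injD[OF inj_chart])
        finally show "v (chart None z) \<le> c" .
      qed
      show "G z \<le> v (chart None z)"
        unfolding v_def by (intro INF_greatest SUP_upper) auto
    qed
    show "\<exists>z. chart None z \<in> U \<and> c < G z" if "c < v p" "open U" "p \<in> U" for p c U
      using less_le_trans[OF that(1) v_le[OF that(2,3)]] by (auto simp: less_SUP_iff)
  qed
qed

lemma measurable_chart [measurable]: "chart j \<in> borel_measurable borel"
  by (intro borel_measurable_continuous_onI continuous_on_chart)

lemma nn_integral_fs_measure:
  fixes f :: "('n::finite) cproj \<Rightarrow> ennreal"
  assumes [measurable]: "f \<in> borel_measurable borel"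
  shows "(\<integral>\<^sup>+p. f p \<partial>fs_measure) = (\<integral>\<^sup>+z. ennreal (fact CARD('n) / pi ^ CARD('n) / (1 + (norm z)\<^sup>2) ^ (CARD('n) + 1))
     * f (chart None z) \<partial>lborel)"
  unfolding fs_measure_def by (simp add: nn_integral_distr nn_integral_density)

lemma one_plus_norm_pos: "0 < 1 + (norm z)\<^sup>2" for z :: "'a::real_normed_vector"
  by (simp add: add_pos_nonneg)

lemma log_plus_le: "max 0 (ln (norm z)) \<le> 1/2 * ln (1 + (norm z)\<^sup>2)" for z :: "'a::real_normed_vector"
proof -
  have "ln (norm z) \<le> 1/2 * ln (1 + (norm z)\<^sup>2)"
  proof (cases "z = 0")
    case False
    then have "2 * ln (norm z) = ln ((norm z)\<^sup>2)" by (simp add: ln_realpow)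
    also have "\<dots> \<le> ln (1 + (norm z)\<^sup>2)" using False by (intro ln_mono) auto
    finally show ?thesis by simp
  qed simp
  moreover have "0 \<le> ln (1 + (norm z)\<^sup>2)" by simp
  ultimately show ?thesis unfolding max_def by simp
qed

lemma le_log_plus: "1/2 * ln (1 + (norm z)\<^sup>2) \<le> max 0 (ln (norm z)) + ln 2" for z :: "'a::real_normed_vector"
proof -
  have l2: "0 \<le> ln (2::real)" by simp
  show ?thesis
  proof (cases "norm z \<le> 1")
    case True
    then have "ln (1 + (norm z)\<^sup>2) \<le> ln 2"
      using power_le_one[of "norm z" 2] by (intro ln_mono one_plus_norm_pos) auto
    then show ?thesis using l2 by linarith
  next
    case False
    then have "1 \<le> (norm z)\<^sup>2" by (simp add: one_le_power)
    then have "ln (1 + (norm z)\<^sup>2) \<le> ln (2 * (norm z)\<^sup>2)"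
      by (intro ln_mono one_plus_norm_pos) auto
    also have "\<dots> = ln 2 + 2 * ln (norm z)" using False by (subst ln_mult) (auto simp: ln_realpow)
    finally show ?thesis using l2 by linarith
  qed
qed

text \<open>
  The growth bound is compactness of projective space; integrability excludes the constant \<open>-\<infinity>\<close>
  because the density is positive everywhere on \<open>U\<^sub>0\<close>.
\<close>

lemma lelong_class_of_omega_psh:
  fixes v :: "('n::finite) cproj \<Rightarrow> ereal"
  assumes v: "v \<in> omega_psh"
  shows "(\<lambda>z. v (chart None z) + ereal (1/2 * ln (1 + (norm z)\<^sup>2))) \<in> lelong_class"
proof -
  have fin: "v p \<noteq> \<infinity>" and usc: "usc_on UNIV v" and int: "(\<integral>\<^sup>+p. e2ennreal \<bar>v p\<bar> \<partial>fs_measure) < \<infinity>"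
    and psh: "psh_on UNIV (\<lambda>z. v (chart j z) + ereal (fs_potential j (chart j z)))" for p j
    using v by (auto simp: omega_psh_def)
  have [measurable]: "v \<in> borel_measurable borel" by (rule usc_borel_measurable[OF usc])
  have "\<exists>z. v (chart None z) \<noteq> -\<infinity>"
  proof (rule ccontr)
    assume "\<not> ?thesis"
    then have "(\<integral>\<^sup>+p. e2ennreal \<bar>v p\<bar> \<partial>fs_measure)
      = (\<integral>\<^sup>+z. ennreal (fact CARD('n) / pi ^ CARD('n) / (1 + (norm (z :: complex ^ 'n))\<^sup>2) ^ (CARD('n) + 1)) * \<infinity> \<partial>lborel)"
      by (subst nn_integral_fs_measure) auto
    also have "\<dots> = (\<integral>\<^sup>+z. \<infinity> \<partial>(lborel :: (complex ^ 'n) measure))"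
      by (intro nn_integral_cong) (simp add: ennreal_mult_top less_imp_neq[OF one_plus_norm_pos, symmetric] one_plus_norm_pos)
    also have "\<dots> = \<infinity>" by (simp add: ennreal_mult_top)
    finally show False using int by simp
  qed
  moreover obtain M where M: "0 \<le> M" "\<And>p. v p \<le> ereal M"
    using usc_bounded_above_on_compact[OF usc fin compact_cproj] by auto
  have "v (chart None z) + ereal (1/2 * ln (1 + (norm z)\<^sup>2)) \<le> ereal (max 0 (ln (norm z)) + (M + ln 2))" for z
  proof -
    have "v (chart None z) + ereal (1/2 * ln (1 + (norm z)\<^sup>2)) \<le> ereal M + ereal (max 0 (ln (norm z)) + ln 2)"
      using M(2) le_log_plus[of z] by (intro add_mono) simp_all
    then show ?thesis by (simp add: algebra_simps)
  qed
  ultimately show ?thesis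
    using psh[of None] unfolding lelong_class_def fs_potential_chart ln_norm_hom_coords_None
    by auto
qed

text \<open>
  Plurisubharmonicity in a chart \<open>U\<^sub>k\<close> other than \<open>U\<^sub>0\<close> is checked separately off the hyperplane \<open>z\<^sub>k = 0\<close>, where the function is
  \<open>u(w(z)) + log |z\<^sub>k|\<close>, and on it, where every value is a limit of values at points with \<open>z\<^sub>k \<noteq> 0\<close>.
\<close>

lemma omega_psh_of_lelong_class:
  fixes u :: "complex ^ 'n::finite \<Rightarrow> ereal"
  assumes u: "u \<in> lelong_class"
  obtains v where "v \<in> omega_psh" "\<And>z. u z = v (chart None z) + ereal (1/2 * ln (1 + (norm z)\<^sup>2))"
proof -
  define \<phi> where "\<phi> z = 1/2 * ln (1 + (norm z)\<^sup>2)" for z :: "complex ^ 'n"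
  have psh: "psh_on UNIV u" and ne: "\<exists>z. u z \<noteq> -\<infinity>"
    and "\<exists>C::real. \<forall>z. u z \<le> ereal (max 0 (ln (norm z)) + C)"
    using u by (auto simp: lelong_class_def)
  then obtain C :: real where C: "\<And>z. u z \<le> ereal (max 0 (ln (norm z)) + C)" by blast
  have fin_u: "u z \<noteq> \<infinity>" and usc_u: "usc_on UNIV u" for z
    using psh by (auto simp: psh_on_def)
  define M where "M = max 0 C"
  have M: "0 \<le> M" by (simp add: M_def)
  have uM: "u z \<le> ereal (M + \<phi> z)" for z
  proof -
    have "max 0 (ln (norm z)) + C \<le> M + \<phi> z"
      using log_plus_le[of z] unfolding \<phi>_def M_def by linarith
    then show ?thesis using C[of z] by (meson ereal_less_eq(3) order_trans)
  qed
  define G where "G z = u z + ereal (- \<phi> z)" for z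
  have uG: "u z = G z + ereal (\<phi> z)" for z
    using fin_u[of z] by (cases "u z") (auto simp: G_def)
  have uscG: "usc_on UNIV G"
    unfolding G_def
    by (intro usc_add usc_u fin_u continuous_imp_usc)
       (auto simp: \<phi>_def intro!: continuous_intros less_imp_neq[OF one_plus_norm_pos, symmetric])
  have GM: "G z \<le> ereal M" for z
    using uM[of z] by (cases "u z") (auto simp: G_def)
  obtain v where v: "usc_on UNIV v" "\<And>p. v p \<le> ereal M" "\<And>z. v (chart None z) = G z"
    "\<And>p c U. c < v p \<Longrightarrow> open U \<Longrightarrow> p \<in> U \<Longrightarrow> \<exists>z. chart None z \<in> U \<and> c < G z"
    using usc_extension[OF uscG GM] by blast
  have fin: "v p \<noteq> \<infinity>" for p using v(2)[of p] by auto
  have "v \<in> omega_psh"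
    unfolding omega_psh_def
  proof (intro CollectI conjI allI fin v(1))
    let ?\<rho> = "\<lambda>z :: complex ^ 'n. 1 / (1 + (norm z)\<^sup>2) ^ (CARD('n) + 1)"
    let ?c = "fact CARD('n) / pi ^ CARD('n) :: real"
    have [measurable]: "v \<in> borel_measurable borel" "u \<in> borel_measurable borel" "G \<in> borel_measurable borel"
      using v(1) usc_u uscG by (auto intro: usc_borel_measurable)
    have [measurable]: "\<phi> \<in> borel_measurable borel" unfolding \<phi>_def by measurable
    obtain a where a: "u a \<noteq> -\<infinity>" using ne by blast
    have I1: "(\<integral>\<^sup>+z. e2ennreal (ereal (M + \<phi> z) - u z) * ennreal (?\<rho> z) \<partial>lborel) < \<infinity>"
      using lelong_deficit_integrable[OF psh a M] uM unfolding \<phi>_def by simp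
    have I2: "(\<integral>\<^sup>+z. ennreal (?\<rho> z) \<partial>lborel) < \<infinity>"
    proof (rule le_less_trans[OF nn_integral_mono nn_integral_radial_weight_finite])
      fix z :: "complex ^ 'n"
      show "ennreal (?\<rho> z) \<le> ennreal ((1 + norm z) / (1 + (norm z)\<^sup>2) ^ (CARD('n) + 1))"
        by (intro ennreal_leI divide_right_mono) auto
    qed
    have "(\<integral>\<^sup>+p. e2ennreal \<bar>v p\<bar> \<partial>fs_measure) = (\<integral>\<^sup>+z. ennreal (?c / (1 + (norm z)\<^sup>2) ^ (CARD('n) + 1)) * e2ennreal \<bar>G z\<bar> \<partial>lborel)"
      by (subst nn_integral_fs_measure) (simp_all add: v(3))
    also have "\<dots> \<le> (\<integral>\<^sup>+z. ennreal ?c * (ennreal M * ennreal (?\<rho> z) + e2ennreal (ereal (M + \<phi> z) - u z) * ennreal (?\<rho> z)) \<partial>lborel)"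
    proof (rule nn_integral_mono)
      fix z :: "complex ^ 'n"
      \<comment> \<open>\<open>G \<le> M\<close> makes the negative part the only one to control.\<close>
      have "\<bar>G z\<bar> \<le> ereal M + (ereal M - G z)"
        using GM[of z] M by (cases "G z") auto
      also have "ereal M - G z = ereal (M + \<phi> z) - u z"
        using fin_u[of z] by (cases "u z") (auto simp: G_def)
      finally have "e2ennreal \<bar>G z\<bar> \<le> e2ennreal (ereal M + (ereal (M + \<phi> z) - u z))"
        by (rule e2ennreal_mono)
      also have "\<dots> = ennreal M + e2ennreal (ereal (M + \<phi> z) - u z)"
        using M uM[of z] by (cases "u z") (auto simp: algebra_simps simp flip: ennreal_plus)
      finally have le: "e2ennreal \<bar>G z\<bar> \<le> ennreal M + e2ennreal (ereal (M + \<phi> z) - u z)" .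
      have dens: "ennreal (?c / (1 + (norm z)\<^sup>2) ^ (CARD('n) + 1)) = ennreal ?c * ennreal (?\<rho> z)"
        by (subst ennreal_mult[symmetric]) auto
      have alg: "x * y * (m + e) = x * (m * y + e * y)" for x y m e :: ennreal
        by (simp only: distrib_right[symmetric] mult.assoc mult.commute[of y])
      have "ennreal (?c / (1 + (norm z)\<^sup>2) ^ (CARD('n) + 1)) * e2ennreal \<bar>G z\<bar>
        \<le> ennreal ?c * ennreal (?\<rho> z) * (ennreal M + e2ennreal (ereal (M + \<phi> z) - u z))"
        using le dens by (simp only: mult_left_mono zero_le)
      then show "ennreal (?c / (1 + (norm z)\<^sup>2) ^ (CARD('n) + 1)) * e2ennreal \<bar>G z\<bar>
        \<le> ennreal ?c * (ennreal M * ennreal (?\<rho> z) + e2ennreal (ereal (M + \<phi> z) - u z) * ennreal (?\<rho> z))"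
        by (simp only: alg)
    qed
    also have "\<dots> = ennreal ?c * (ennreal M * (\<integral>\<^sup>+z. ennreal (?\<rho> z) \<partial>lborel)
        + (\<integral>\<^sup>+z. e2ennreal (ereal (M + \<phi> z) - u z) * ennreal (?\<rho> z) \<partial>lborel))"
      by (simp add: nn_integral_cmult nn_integral_add)
    also have "\<dots> < \<infinity>"
      using I1 I2 by (auto simp: ennreal_mult_less_top)
    finally show "(\<integral>\<^sup>+p. e2ennreal \<bar>v p\<bar> \<partial>fs_measure) < \<infinity>" .
  next
    fix j :: "'n option"
    define F where "F z = v (chart j z) + ereal (ln (norm (hom_coords j z)))" for z
    have "psh_on UNIV F"
    proof (cases j)
      case None
      then have "F = u"
        by (intro ext) (simp add: F_def v(3) uG \<phi>_def ln_norm_hom_coords_None)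
      then show ?thesis using psh by simp
    next
      case (Some k)
      \<comment> \<open>The change of charts from \<open>U\<^sub>k\<close> to \<open>U\<^sub>0\<close>.\<close>
      define w where "w z = inverse (z $ k) *s (\<chi> i. if i = k then 1 else z $ i)" for z :: "complex ^ 'n"
      have at0: "hom_coords j z $ None = z $ k" for z
        by (simp add: hom_coords_def Some)
      have w: "aff_coords None (hom_coords j z) = w z" for z
        by (simp add: aff_coords_def hom_coords_def Some w_def vec_eq_iff divide_inverse mult.commute)
      have vw: "v (chart j z) = G (w z)" if "z $ k \<noteq> 0" for z
        using chart_aff_coords[of "hom_coords j z" None] that by (simp add: at0 w chart_eq_proj[of j] v(3)[symmetric])
      have \<phi>w: "\<phi> (w z) = ln (norm (hom_coords j z)) - ln (cmod (z $ k))" if "z $ k \<noteq> 0" for z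
      proof -
        have "\<phi> (w z) = fs_potential None (chart None (w z))"
          by (simp add: \<phi>_def fs_potential_chart ln_norm_hom_coords_None)
        also have "chart None (w z) = proj (hom_coords j z)"
          using chart_aff_coords[of "hom_coords j z" None] that by (simp add: at0 w)
        also have "fs_potential None (proj (hom_coords j z)) = ln (norm (hom_coords j z) / cmod (z $ k))"
          using that by (subst fs_potential_proj) (simp_all add: at0)
        finally show ?thesis using that by (simp add: ln_div)
      qed
      have F: "F z = u (w z) + ereal (ln (cmod (z $ k)))" if "z $ k \<noteq> 0" for z
        unfolding F_def vw[OF that] G_def \<phi>w[OF that] by (cases "u (w z)") auto
      have finF: "F z \<noteq> \<infinity>" for z using fin by (simp add: F_def)
      have uscF: "usc_on UNIV F"
        unfolding F_def
        by (intro usc_add usc_compose[OF v(1)] continuous_on_chart continuous_imp_usc continuous_on_ln_norm_hom_coords fin) simp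
      have off: "F a \<le> circle_mean F a b" if "a $ k \<noteq> 0" for a b
        using psh_projective_submean[OF psh uscF finF F[unfolded w_def] that] .
      have "F a \<le> circle_mean F a b" for a b
      proof (rule dense_le)
        fix t assume t: "t < F a"
        show "t \<le> circle_mean F a b"
        proof (cases t)
          case (real s)
          define c where "c = s - ln (norm (hom_coords j a))"
          have c: "ereal c < v (chart j a)"
            using t real fin[of "chart j a"] by (cases "v (chart j a)") (auto simp: F_def c_def)
          \<comment> \<open>Points off the hyperplane that approach \<open>a\<close> while the extension stays above \<open>c\<close>.\<close>
          have "\<exists>x. x \<in> ball a (1 / real (Suc n)) \<and> x $ k \<noteq> 0 \<and> ereal c < v (chart j x)" for n
          proof -
            have "open (chart j ` ball a (1 / real (Suc n)))" "chart j a \<in> chart j ` ball a (1 / real (Suc n))"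
              by (auto intro!: open_chart_image)
            from v(4)[OF c this] obtain y x where yx: "chart None y = chart j x" "x \<in> ball a (1 / real (Suc n))" "ereal c < G y"
              by auto
            then have "hom_coords j x $ None \<noteq> 0"
              using proj_eq_chart_iff[of "hom_coords j x" None y] by (simp add: chart_eq_proj[of j])
            then show ?thesis using yx v(3)[of y] by (auto simp: at0)
          qed
          then obtain x where x: "\<And>n. x n \<in> ball a (1 / real (Suc n))" "\<And>n. x n $ k \<noteq> 0" "\<And>n. ereal c < v (chart j (x n))"
            by metis
          have "x \<longlonglongrightarrow> a"
          proof (rule metric_LIMSEQ_I)
            fix r :: real assume "0 < r"
            then obtain n0 where n0: "1 / real (Suc n0) < r" by (metis nat_approx_posE)
            show "\<exists>no. \<forall>n\<ge>no. dist (x n) a < r"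
            proof (intro exI allI impI)
              fix n assume "n0 \<le> n"
              then have "1 / real (Suc n) \<le> 1 / real (Suc n0)" by (intro divide_left_mono) auto
              then show "dist (x n) a < r" using x(1)[of n] n0 by (simp add: dist_commute)
            qed
          qed
          moreover have "(\<lambda>n. c + ln (norm (hom_coords j (x n)))) \<longlonglongrightarrow> c + ln (norm (hom_coords j a))"
          proof -
            have "isCont (\<lambda>z. ln (norm (hom_coords j z))) a"
              using continuous_on_ln_norm_hom_coords[of UNIV j] by (simp add: continuous_on_eq_continuous_at)
            from isCont_tendsto_compose[OF this \<open>x \<longlonglongrightarrow> a\<close>] show ?thesis
              by (intro tendsto_add tendsto_const)
          qed
          moreover have "ereal (c + ln (norm (hom_coords j (x n)))) \<le> circle_mean F (x n) b" for n
          proof -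
            have "ereal (c + ln (norm (hom_coords j (x n)))) \<le> F (x n)"
              using x(3)[of n] by (cases "v (chart j (x n))") (auto simp: F_def)
            also have "\<dots> \<le> circle_mean F (x n) b" by (rule off[OF x(2)])
            finally show ?thesis .
          qed
          ultimately have "ereal (c + ln (norm (hom_coords j a))) \<le> circle_mean F a b"
            by (rule circle_mean_ge_limit[OF uscF finF])
          then show ?thesis using real by (simp add: c_def)
        qed (use t in auto)
      qed
      then show ?thesis using uscF finF by (simp add: psh_on_def)
    qed
    then show "psh_on UNIV (\<lambda>z. v (chart j z) + ereal (fs_potential j (chart j z)))"
      by (simp add: F_def[abs_def] fs_potential_chart)
  qed
  then show ?thesis using that[of v] by (simp add: uG v(3) \<phi>_def)
qed

text \<open>
  Both parts of the theorem provide \<open>q = Q + \<phi>\<close> on \<open>U\<^sub>0\<close>.  Under this relation adding \<open>\<phi>\<close> translates one family of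
  competitors into the other.
\<close>

lemma V_aff_eq_V_omega:
  fixes K :: "(complex ^ 'n::finite) set"
  assumes q: "\<And>z. q z = Q (chart None z) + ereal (1/2 * ln (1 + (norm z)\<^sup>2))"
  shows "V_aff K q x = V_omega (chart None ` K) Q (chart None x) + ereal (1/2 * ln (1 + (norm x)\<^sup>2))"
proof -
  define \<phi> where "\<phi> z = ereal (1/2 * ln (1 + (norm z)\<^sup>2))" for z :: "complex ^ 'n"
  have q': "q z = Q (chart None z) + \<phi> z" for z using q by (simp add: \<phi>_def)
  have cancel: "s + \<phi> z \<le> t + \<phi> z \<longleftrightarrow> s \<le> t" for s t z
    by (cases s; cases t) (auto simp: \<phi>_def)
  define W where "W = {v \<in> omega_psh. \<forall>p\<in>chart None ` K. v p \<le> Q p}"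
  have "{u x | u. u \<in> lelong_class \<and> (\<forall>z\<in>K. u z \<le> q z)} = (\<lambda>v. v (chart None x) + \<phi> x) ` W"
  proof (intro equalityI subsetI)
    fix t assume "t \<in> {u x | u. u \<in> lelong_class \<and> (\<forall>z\<in>K. u z \<le> q z)}"
    then obtain u where u: "t = u x" "u \<in> lelong_class" "\<forall>z\<in>K. u z \<le> q z" by blast
    obtain v where v: "v \<in> omega_psh" "\<And>z. u z = v (chart None z) + \<phi> z"
      using omega_psh_of_lelong_class[OF u(2)] unfolding \<phi>_def by blast
    have "v \<in> W" using u(3) v(1) by (auto simp: W_def v(2) q' cancel)
    then show "t \<in> (\<lambda>v. v (chart None x) + \<phi> x) ` W" using u(1) v(2) by auto
  next
    fix t assume "t \<in> (\<lambda>v. v (chart None x) + \<phi> x) ` W"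
    then obtain v where v: "v \<in> W" "t = v (chart None x) + \<phi> x" by blast
    then have "(\<lambda>z. v (chart None z) + \<phi> z) \<in> lelong_class"
      unfolding \<phi>_def by (intro lelong_class_of_omega_psh) (simp add: W_def)
    then show "t \<in> {u x | u. u \<in> lelong_class \<and> (\<forall>z\<in>K. u z \<le> q z)}"
      using v by (auto simp: W_def q' cancel intro!: exI[of _ "\<lambda>z. v (chart None z) + \<phi> z"])
  qed
  then have "V_aff K q x = (SUP v\<in>W. v (chart None x) + \<phi> x)" by (simp add: V_aff_def)
  also have "\<dots> = (SUP v\<in>W. v (chart None x)) + \<phi> x"
  proof (cases "W = {}")
    case False
    then show ?thesis by (rule SUP_ereal_add_left) (simp add: \<phi>_def)
  qed (simp add: \<phi>_def bot_ereal_def)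
  also have "(SUP v\<in>W. v (chart None x)) = V_omega (chart None ` K) Q (chart None x)"
    unfolding V_omega_def W_def by (intro arg_cong[where f = Sup]) auto
  finally show ?thesis by (simp add: \<phi>_def)
qed

theorem proposition4:
  fixes K :: "(complex ^ 'n::finite) set"
  assumes "K \<in> sets borel"
  shows "(\<forall>(Q :: 'n cproj \<Rightarrow> ereal) (q :: complex ^ 'n \<Rightarrow> ereal).
            mild Q \<and>
            (\<forall>Z. Z $ None \<noteq> 0 \<longrightarrow>
               q (affine_coords Z) = Q (proj Z) + ereal (ln (norm Z / cmod (Z $ None)))) \<longrightarrow>
            (\<forall>x. V_aff K q x =
               V_omega (chart None ` K) Q (chart None x) + ereal (1/2 * ln (1 + (norm x)\<^sup>2)))) \<and>
         (\<forall>(q :: complex ^ 'n \<Rightarrow> ereal) (Q :: 'n cproj \<Rightarrow> ereal).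
            (\<forall>z. q z \<noteq> -\<infinity>) \<and> lsc_on UNIV q \<and>
            (\<forall>Z. Z $ None \<noteq> 0 \<longrightarrow>
               Q (proj Z) = q (affine_coords Z) - ereal (ln (norm Z)) + ereal (ln (cmod (Z $ None)))) \<and>
            (\<forall>p. p \<notin> chart_domain None \<longrightarrow> Q p = Liminf (at p within chart_domain None) Q) \<longrightarrow>
            (\<forall>x. V_aff K q x =
               V_omega (chart None ` K) Q (chart None x) + ereal (1/2 * ln (1 + (norm x)\<^sup>2))))"
proof (intro conjI allI impI)
  have aff: "affine_coords (hom_coords None z) = z" for z :: "complex ^ 'n"
    using aff_coords_hom_coords[of None z] by (simp add: affine_coords_def aff_coords_def)
  {
    fix Q :: "'n cproj \<Rightarrow> ereal" and q :: "complex ^ 'n \<Rightarrow> ereal" and x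
    assume h: "mild Q \<and> (\<forall>Z. Z $ None \<noteq> 0 \<longrightarrow>
               q (affine_coords Z) = Q (proj Z) + ereal (ln (norm Z / cmod (Z $ None))))"
    have "q z = Q (chart None z) + ereal (1/2 * ln (1 + (norm z)\<^sup>2))" for z
      using conjunct2[OF h, rule_format, of "hom_coords None z"]
      by (simp add: aff chart_eq_proj ln_norm_hom_coords_None)
    then show "V_aff K q x = V_omega (chart None ` K) Q (chart None x) + ereal (1/2 * ln (1 + (norm x)\<^sup>2))"
      by (rule V_aff_eq_V_omega)
  }
  {
    fix Q :: "'n cproj \<Rightarrow> ereal" and q :: "complex ^ 'n \<Rightarrow> ereal" and x
    assume h: "(\<forall>z. q z \<noteq> -\<infinity>) \<and> lsc_on UNIV q \<and>
            (\<forall>Z. Z $ None \<noteq> 0 \<longrightarrow>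
               Q (proj Z) = q (affine_coords Z) - ereal (ln (norm Z)) + ereal (ln (cmod (Z $ None)))) \<and>
            (\<forall>p. p \<notin> chart_domain None \<longrightarrow> Q p = Liminf (at p within chart_domain None) Q)"
    have "q z = Q (chart None z) + ereal (1/2 * ln (1 + (norm z)\<^sup>2))" for z
    proof -
      have "Q (chart None z) = q z - ereal (1/2 * ln (1 + (norm z)\<^sup>2))"
        using conjunct1[OF conjunct2[OF conjunct2[OF h]], rule_format, of "hom_coords None z"]
        by (simp add: aff chart_eq_proj ln_norm_hom_coords_None)
      then show ?thesis by (cases "q z") auto
    qed
    then show "V_aff K q x = V_omega (chart None ` K) Q (chart None x) + ereal (1/2 * ln (1 + (norm x)\<^sup>2))"
      by (rule V_aff_eq_V_omega)
  }
qed

end
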